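(* There is a positive constant $C$ such that for every sufficiently large $m$ there is a $C_4$-free bipartite graph $G=(X,Y,E)$ with $|X|\geq \frac12 m^{3/4}\log^2 m$ and $|Y|=(1+o(1))m$ (as $m\to\infty$), such that: (1) $d(y)\leq 2m^{1/4}\log^2 m$ for every $y\in Y$; (2) for every set $X'\subseteq X$ with $|X'|\geq C m^{1/4}\log^2 m$ there exists $y\in Y$ with $|N(y)\cap X'|\geq 3$.
   Context: $C_4$ is the cycle of length $4$; a graph is $C_4$-free if it contains no (not necessarily induced) $C_4$. $d(y)$ and $N(y)$ denote the degree and neighbourhood of $y$ in $G$. *)

theory Defs
  imports Complex_Main "HOL-Library.Landau_Symbols"
begin

text \<open>An undirected edge is the two-element set of its endpoints.\<close>

definition bipartite_graph :: "'a set \<Rightarrow> 'a set \<Rightarrow> 'a set set \<Rightarrow> bool" where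
  "bipartite_graph X Y E \<longleftrightarrow>
     finite X \<and> finite Y \<and> X \<inter> Y = {} \<and> E \<subseteq> {{x, y} | x y. x \<in> X \<and> y \<in> Y}"

definition neighbourhood :: "'a set set \<Rightarrow> 'a \<Rightarrow> 'a set" where
  "neighbourhood E v = {u. {u, v} \<in> E}"

definition vertex_degree :: "'a set set \<Rightarrow> 'a \<Rightarrow> nat" where
  "vertex_degree E v = card (neighbourhood E v)"

definition C4_free :: "'a set set \<Rightarrow> bool" where
  "C4_free E \<longleftrightarrow>
     \<not> (\<exists>a b c d. distinct [a, b, c, d] \<and>
          {a, b} \<in> E \<and> {b, c} \<in> E \<and> {c, d} \<in> E \<and> {d, a} \<in> E)"

end

(* Take a random set X of about m^(3/4) log^2 m / 2 points of a union of disjoint affine planes over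
   Z_q with q of order sqrt m and about m points and lines altogether, and let Y be the set of lines.
   Two lines share at most one point, so the incidence graph is C4-free, and a union bound over
   subsets of lines limits the degrees. For (2) one has to show that X contains no arc (set without
   three collinear points) of size t = C m^(1/4) log^2 m, which follows from the union bound once the
   arcs of size t are known to be few.

   The arcs are counted with containers. If S has at least a large constant times q points, then many
   triples of S are collinear, and a Kleitman-Winston type argument encodes every arc inside S by
   O(sqrt q) of its points and a subset of S that is smaller by a constant factor. After O(log q)
   rounds the remaining set has O(q) points. So there are exp(O(sqrt q log^2 q)) containers with O(q)
   points each, hence at most exp(O(sqrt q log^2 q)) (O(q) choose t) arcs of size t. For large C, the
   exponent is small compared to t and the density of X is small compared to t / q. *)
theory Submission
  imports Defs "HOL-Library.Countable" "HOL-Library.Disjoint_Sets" "HOL-Number_Theory.Cong"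
    "HOL-Real_Asymp.Real_Asymp"
begin

text \<open>The square of the logarithm comes from the encoding. A round costs \<open>s\<close>
  picks in a first phase and a multiple of \<open>q / s\<close> picks in a second one, which
  balances at \<open>s\<close> near \<open>sqrt q\<close>, of order \<open>m powr (1 / 4)\<close>.
  Every pick costs a factor \<open>card V + 1\<close> in the number of containers, hence one factor
  \<open>ln m\<close> in the exponent; the number of rounds is the other. An arc size
  \<open>t\<close> above this exponent pays for the containers. A container has order
  \<open>m powr (1 / 2)\<close> points, so its expected share of \<open>X\<close> is of order
  \<open>m powr (1 / 4) * (ln m)\<^sup>2\<close>, a small fraction of such a \<open>t\<close>. For
  the rate of shrinking to be constant, \<open>m \<le> K * q\<^sup>2\<close> must hold with a
  constant \<open>K\<close>. A prime between consecutive powers of 4 gives this with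
  \<open>K = 1024\<close>, and an elementary bound of Chebyshev type provides that prime.\<close>

section \<open>Primes between powers of 4\<close>

text \<open>By induction on \<open>k\<close>, this recursion shows that a common multiple of \<open>1, \<dots>, n\<close> is
  divisible by \<open>k * (n choose k)\<close>, without any computation of valuations.\<close>

lemma leibniz_triangle:
  assumes "k \<ge> 1" "k < n"
  shows "1 / real (Suc k * (n choose Suc k)) =
     1 / real (k * (n - 1 choose k)) - 1 / real (k * (n choose k))"
proof -
  obtain l where n: "n = Suc l" using assms by (cases n) auto
  define a where "a = real (l choose k)"
  have a: "a > 0" unfolding a_def using assms n by simp
  have 1: "real (Suc k * (n choose Suc k)) = real n * a"
    unfolding a_def n by (metis Suc_times_binomial of_nat_mult)
  have "(n - k) * (n choose k) = n * (l choose k)"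
    using binomial_absorb_comp[of n k] n by simp
  hence "(real n - real k) * real (n choose k) = real n * a"
    unfolding a_def using assms by (metis less_imp_le of_nat_diff of_nat_mult)
  hence 2: "real (n choose k) = real n * a / (real n - real k)"
    using assms by (simp add: field_simps)
  have 3: "real (k * (n - 1 choose k)) = real k * a" unfolding a_def n by simp
  have "real k > 0" "real n > 0" "real n - real k > 0" using assms by auto
  thus ?thesis unfolding 1 3 of_nat_mult[of k "n choose k"] 2 using a
    by (simp add: field_simps)
qed

lemma mult_binomial_dvd_common_multiple:
  assumes "1 \<le> k" "k \<le> n" "\<And>i. 1 \<le> i \<Longrightarrow> i \<le> n \<Longrightarrow> i dvd d"
  shows "k * (n choose k) dvd d"
proof -
  \<comment> \<open>Divisibility is read as integrality of a quotient: the triangle identity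
    multiplied by \<open>d\<close> writes the next quotient as a difference of two integers.\<close>
  have "real d / real (k * (n choose k)) \<in> \<int>"
    using assms
  proof (induction k arbitrary: n rule: nat_induct_at_least)
    case base
    then obtain c where "d = n * c" by (meson dvdE le_refl)
    thus ?case using base by auto
  next
    case (Suc k)
    have "real d / real (k * (n - 1 choose k)) \<in> \<int>" "real d / real (k * (n choose k)) \<in> \<int>"
      using Suc.prems by (intro Suc.IH; simp)+
    moreover have "real d / real (Suc k * (n choose Suc k)) =
        real d / real (k * (n - 1 choose k)) - real d / real (k * (n choose k))"
      using leibniz_triangle[of k n] Suc.hyps Suc.prems
      by (metis (no_types, opaque_lifting) Suc_le_lessD mult.right_neutral right_diff_distrib times_divide_eq_right)
    ultimately show ?case by (metis Ints_diff)
  qed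
  then obtain z :: int where z: "real d / real (k * (n choose k)) = of_int z" by (auto elim: Ints_cases)
  have p: "k * (n choose k) > 0" using assms by simp
  hence "real d = of_int z * real (k * (n choose k))" using z
    by (metis nonzero_eq_divide_eq of_nat_0_less_iff order_less_irrefl)
  hence "int d = z * int (k * (n choose k))" by (metis of_int_eq_iff of_int_mult of_int_of_nat_eq)
  thus ?thesis by (metis dvd_triv_right int_dvd_int_iff)
qed

lemma central_binomial_upper: "(2 * n choose n) \<le> (4::nat) ^ n"
proof -
  have "(2 * n choose n) \<le> 2 ^ (2 * n)" by (rule binomial_le_pow2)
  thus ?thesis by (simp add: power_mult)
qed

lemma prod_primes_dvd:
  fixes d :: nat
  assumes "finite A" "\<And>p. p \<in> A \<Longrightarrow> prime p \<and> p dvd d"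
  shows "\<Prod>A dvd d"
  using assms
proof (induction A rule: finite_induct)
  case (insert p A)
  have "coprime p (\<Prod>A)"
    by (rule prod_coprime_right) (metis insert.hyps(2) insert.prems insertCI primes_coprime)
  with insert show ?case by (simp add: divides_mult)
qed simp

text \<open>The primes above \<open>2 ^ k\<close> and up to twice that divide the central binomial
  coefficient, so their product is at most \<open>4 ^ (2 ^ k)\<close>, and the exponents add up by
  doubling. Keeping to powers of two avoids a parity split.\<close>

lemma primorial_power2_le: "\<Prod>{p. prime p \<and> p \<le> (2::nat) ^ k} \<le> 4 ^ (2 ^ k)"
proof (induction k)
  case 0
  have "{p. prime p \<and> p \<le> (2::nat) ^ 0} = {}" by (auto dest: prime_gt_1_nat)
  thus ?case by (simp only: prod.empty) simp
next
  case (Suc k)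
  let ?n = "(2::nat) ^ k" and ?B = "{p. prime p \<and> (2::nat) ^ k < p \<and> p \<le> 2 * 2 ^ k}"
  have fin: "finite ?B" "finite {p. prime p \<and> p \<le> ?n}" by auto
  have "\<Prod>?B dvd (2 * ?n choose ?n)"
  proof (rule prod_primes_dvd[OF fin(1)])
    fix p assume p: "p \<in> ?B"
    have "p dvd fact (2 * ?n)" using p by (simp add: prime_dvd_fact_iff)
    also have "fact (2 * ?n) = fact ?n * fact (2 * ?n - ?n) * (2 * ?n choose ?n)"
      by (rule binomial_fact_lemma[symmetric]) simp
    finally have "p dvd fact ?n * fact ?n * (2 * ?n choose ?n)" by simp
    moreover have "\<not> p dvd fact ?n" using p by (simp add: prime_dvd_fact_iff)
    ultimately show "prime p \<and> p dvd (2 * ?n choose ?n)"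
      using p by (simp add: prime_dvd_mult_iff)
  qed
  hence "\<Prod>?B \<le> (2 * ?n choose ?n)" by (rule dvd_imp_le) simp
  hence B: "\<Prod>?B \<le> 4 ^ ?n" using central_binomial_upper le_trans by blast
  have "{p. prime p \<and> p \<le> (2::nat) ^ Suc k} = {p. prime p \<and> p \<le> ?n} \<union> ?B" by auto
  hence "\<Prod>{p. prime p \<and> p \<le> (2::nat) ^ Suc k} = \<Prod>{p. prime p \<and> p \<le> ?n} * \<Prod>?B"
    using fin by (simp add: prod.union_disjoint[symmetric] disjoint_iff)
  also have "\<dots> \<le> 4 ^ ?n * 4 ^ ?n" by (rule mult_le_mono[OF Suc B])
  finally show ?case by (simp add: power_add[symmetric] mult_2)
qed

text \<open>The comparison of exponents that refutes the absence of a prime in the next lemma. It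
  fails at \<open>j = 3\<close>, with 129 against 128, hence the threshold 4.\<close>

lemma square_gt_affine: "j \<ge> 4 \<Longrightarrow> (j + 1) * 2 ^ (j + 2) + 1 < (2::nat) * 4 ^ j"
proof -
  assume "j \<ge> 4"
  hence "2 * (j + 1) + 1 \<le> (2::nat) ^ j"
    by (induction j rule: nat_induct_at_least) auto
  hence "(2 * (j + 1) + 1) * 2 ^ j \<le> (2::nat) ^ j * 2 ^ j" by (rule mult_le_mono1)
  also have "\<dots> = 4 ^ j" by (simp flip: power_mult_distrib)
  finally have "2 * (j + 1) * 2 ^ j + 2 ^ j \<le> (4::nat) ^ j" by (simp add: algebra_simps)
  moreover have "(2::nat) ^ j \<ge> 1" by simp
  moreover have "(j + 1) * 2 ^ (j + 2) = 4 * ((j + 1) * (2::nat) ^ j)"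
    "2 * (j + 1) * 2 ^ j = 2 * ((j + 1) * (2::nat) ^ j)" by simp_all
  ultimately show ?thesis by linarith
qed

text \<open>Chebyshev's argument: for \<open>N = 4 ^ (j + 1)\<close> the least common multiple of
  \<open>1, ..., N\<close> is at least \<open>2 ^ (N - 1)\<close>. Without primes above
  \<open>N / 4\<close> it would be at most \<open>4 ^ (N / 4)\<close>, up to the contribution of
  primes below \<open>sqrt N\<close>. With a factor 2 between the ends, the main terms of these
  bounds would coincide; the factor 4 leaves ample room.\<close>

lemma prime_between_powers_of_4:
  assumes j: "j \<ge> 4"
  shows "\<exists>q::nat. prime q \<and> 4 ^ j < q \<and> q \<le> 4 ^ (j + 1)"
proof (rule ccontr)
  assume no: "\<not> ?thesis"
  define N :: nat where "N = 4 ^ (j + 1)"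
  define e where "e = (\<lambda>p. GREATEST i. p ^ i \<le> N)"
  define Q where "Q = {p. prime p \<and> p \<le> N}"
  \<comment> \<open>The least common multiple of \<open>1, ..., N\<close>, given by its prime
    factorization so that it can also be bounded from above.\<close>
  define d where "d = (\<Prod>p\<in>Q. p ^ e p)"
  have N: "N \<ge> 1" unfolding N_def by simp
  have bd: "i \<le> N" if "p ^ i \<le> N" "prime p" for p i
    using power_gt_expt[of p i] prime_gt_1_nat[of p] that by simp
  have e1: "p ^ e p \<le> N" if "prime p" for p
    unfolding e_def by (rule GreatestI_nat[of "\<lambda>i. p ^ i \<le> N" 0 N]) (use that N bd in auto)
  have e2: "i \<le> e p" if "prime p" "p ^ i \<le> N" for p i
    unfolding e_def by (rule Greatest_le_nat[of "\<lambda>i. p ^ i \<le> N" _ N]) (use that N bd in auto)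
  have fQ: "finite Q" unfolding Q_def by auto
  have div: "i dvd d" if i: "1 \<le> i" "i \<le> N" for i
  proof -
    have "i = (\<Prod>p\<in>prime_factors i. p ^ multiplicity p i)"
      using i by (simp add: prod_prime_factors)
    also have "\<dots> dvd d" unfolding d_def
    proof (rule prod_dvd_prod_subset2[OF fQ])
      show "prime_factors i \<subseteq> Q" unfolding Q_def using i by (auto simp: prime_factors_dvd intro: le_trans[OF dvd_imp_le])
      fix p assume "p \<in> prime_factors i"
      hence p: "prime p" by auto
      have "p ^ multiplicity p i dvd i" by (rule multiplicity_dvd)
      hence "p ^ multiplicity p i \<le> N" using i dvd_imp_le[of "p ^ multiplicity p i" i] by simp
      thus "p ^ multiplicity p i dvd p ^ e p" using e2[OF p] by (simp add: le_imp_power_dvd)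
    qed
    finally show ?thesis .
  qed
  define h :: nat where "h = 2 * 4 ^ j"
  have Nh: "N = 2 * h" unfolding N_def h_def by simp
  have h: "h \<ge> 1" "h \<le> N" unfolding Nh h_def by auto
  have dpos: "d > 0" unfolding d_def Q_def by (auto intro!: prod_pos simp: prime_gt_0_nat)
  have "h * (N choose h) dvd d" using mult_binomial_dvd_common_multiple[OF h div] by blast
  hence low: "h * (N choose h) \<le> d" using dpos by (rule dvd_imp_le)
  have "4 ^ h / (2 * real h) \<le> real (2 * h choose h)"
    by (rule central_binomial_lower_bound) (use h in simp)
  hence "4 ^ h \<le> 2 * (real h * real (2 * h choose h))"
    using h by (simp add: field_simps)
  hence "(4::nat) ^ h \<le> 2 * (h * (N choose h))" unfolding Nh
    by (metis (mono_tags, lifting) of_nat_le_iff of_nat_mult of_nat_numeral of_nat_power)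
  hence low': "4 ^ h \<le> 2 * d" using low by simp
  define R where "R = {p. prime p \<and> p \<le> (2::nat) ^ (2 * j)}"
  have QR: "Q = R"
    proof -
    have "p \<le> N \<longleftrightarrow> p \<le> 4 ^ j" if "prime p" for p
    proof
      show "p \<le> N \<Longrightarrow> p \<le> 4 ^ j" using no that unfolding N_def by (meson not_le)
      have "(4::nat) ^ j \<le> N" unfolding N_def by simp
      thus "p \<le> 4 ^ j \<Longrightarrow> p \<le> N" by simp
    qed
    moreover have "(2::nat) ^ (2 * j) = 4 ^ j" by (simp add: power_mult)
    ultimately show ?thesis unfolding Q_def R_def by auto
  qed
  \<comment> \<open>\<open>2 ^ (j + 1)\<close> is the square root of \<open>N\<close>. Primes up to
    it contribute at most \<open>N\<close> each; larger ones divide \<open>d\<close> at most once,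
    so the primorial bound covers them.\<close>
  define A where "A = {p \<in> R. p \<le> 2 ^ (j + 1)}"
  have fR: "finite R" using fQ QR by simp
  have "d = (\<Prod>p\<in>A. p ^ e p) * (\<Prod>p\<in>R - A. p ^ e p)"
    unfolding d_def QR A_def using fR by (subst prod.subset_diff[of "{p \<in> R. p \<le> 2 ^ (j + 1)}" R]) (auto simp: mult.commute)
  also have "\<dots> \<le> N ^ (2 ^ (j + 1)) * 4 ^ (2 ^ (2 * j))"
  proof (rule mult_le_mono)
    have "(\<Prod>p\<in>A. p ^ e p) \<le> (\<Prod>p\<in>A. N)"
      by (rule prod_mono) (use e1 in \<open>auto simp: A_def R_def\<close>)
    also have "\<dots> = N ^ card A" by simp
    also have "\<dots> \<le> N ^ (2 ^ (j + 1))"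
    proof (rule power_increasing[OF _ N])
      have "A \<subseteq> {1..2 ^ (j + 1)}" unfolding A_def R_def using prime_ge_1_nat by auto
      thus "card A \<le> 2 ^ (j + 1)" using card_mono[of "{1..2 ^ (j + 1)}" A] by simp
    qed
    finally show "(\<Prod>p\<in>A. p ^ e p) \<le> N ^ (2 ^ (j + 1))" .
    have "(\<Prod>p\<in>R - A. p ^ e p) \<le> (\<Prod>p\<in>R - A. p)"
    proof (rule prod_mono, safe)
      fix p assume p: "p \<in> R" "p \<notin> A"
      hence pp: "prime p" "2 ^ (j + 1) < p" unfolding A_def R_def by auto
      have "N = 2 ^ (j + 1) * 2 ^ (j + 1)" unfolding N_def by (simp flip: power_mult_distrib)
      also have "\<dots> < p * p" using pp by (intro mult_strict_mono) auto
      finally have Np: "N < p ^ 2" by (simp add: power2_eq_square)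
      have "e p \<le> 1"
      proof (rule ccontr)
        assume "\<not> e p \<le> 1"
        hence "p ^ 2 \<le> p ^ e p" using pp prime_ge_1_nat by (intro power_increasing) auto
        thus False using e1[OF pp(1)] Np by simp
      qed
      thus "p ^ e p \<le> p" using prime_ge_1_nat[OF pp(1)] by (cases "e p") auto
    qed
    also have "\<dots> \<le> (\<Prod>p\<in>R. p)"
    proof (rule dvd_imp_le)
      show "\<Prod>(R - A) dvd \<Prod>R" using fR by (intro prod_dvd_prod_subset) auto
      show "0 < \<Prod>R" by (rule prod_pos) (auto simp: R_def prime_gt_0_nat)
    qed
    also have "\<dots> \<le> 4 ^ (2 ^ (2 * j))" unfolding R_def using primorial_power2_le by simp
    finally show "(\<Prod>p\<in>R - A. p ^ e p) \<le> 4 ^ (2 ^ (2 * j))" .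
  qed
  finally have up: "d \<le> N ^ (2 ^ (j + 1)) * 4 ^ (2 ^ (2 * j))" .
  have pw: "N ^ (2 ^ (j + 1)) * 4 ^ (2 ^ (2 * j)) = (2::nat) ^ ((j + 1) * 2 ^ (j + 2) + 2 * 4 ^ j)"
  proof -
    have "N ^ (2 ^ (j + 1)) = 4 ^ ((j + 1) * 2 ^ (j + 1))" unfolding N_def by (simp only: power_mult)
    hence "N ^ (2 ^ (j + 1)) = (2 ^ 2) ^ ((j + 1) * 2 ^ (j + 1))" by (simp only: power2_eq_square) simp
    moreover have "(4::nat) ^ (2 ^ (2 * j)) = (2 ^ 2) ^ (4 ^ j)" by (simp add: power_mult)
    ultimately show ?thesis by (simp only: power_mult[symmetric] power_add[symmetric]) (simp add: algebra_simps)
  qed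
  have "(4::nat) ^ h = 2 ^ (4 * 4 ^ j)"
  proof -
    have "(4::nat) ^ h = (2 ^ 2) ^ (2 * 4 ^ j)" unfolding h_def by simp
    thus ?thesis by (simp only: power_mult[symmetric]) simp
  qed
  hence "(2::nat) ^ (4 * 4 ^ j) \<le> 2 * 2 ^ ((j + 1) * 2 ^ (j + 2) + 2 * 4 ^ j)"
    using up low' unfolding pw by linarith
  also have "\<dots> = 2 ^ (((j + 1) * 2 ^ (j + 2) + 2 * 4 ^ j) + 1)" by (simp only: power_Suc Suc_eq_plus1[symmetric])
  finally have "(2::nat) ^ (4 * 4 ^ j) \<le> 2 ^ (((j + 1) * 2 ^ (j + 2) + 2 * 4 ^ j) + 1)" .
  hence "4 * 4 ^ j \<le> ((j + 1) * 2 ^ (j + 2) + 2 * 4 ^ j) + (1::nat)"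
    by (subst (asm) power_increasing_iff) auto
  thus False using square_gt_affine[OF j] by simp
qed

section \<open>Containers in block systems\<close>

text \<open>The counting half of the Kleitman--Winston method. A state is a partially examined set; its two
  successors record that the point examined next is outside or inside the target set \<open>A\<close>. The
  second outcome always lowers \<open>pot\<close>, so a branch is determined by at most \<open>pot st\<close> of its at most
  \<open>sz st\<close> steps.\<close>

lemma branching_cover:
  fixes con :: "'a \<Rightarrow> 'st \<Rightarrow> bool" and sz pot :: "'st \<Rightarrow> nat"
  assumes step: "\<And>st. Inv st \<Longrightarrow> \<not> final st \<Longrightarrow> \<exists>st0 st1. Inv st0 \<and> Inv st1 \<and>
      sz st0 < sz st \<and> sz st1 < sz st \<and> pot st0 \<le> pot st \<and> pot st1 < pot st \<and>
      (\<forall>A. con A st \<longrightarrow> con A st0 \<or> con A st1)"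
    and "Inv st"
  shows "\<exists>T. finite T \<and> card T \<le> (sz st + 1) ^ pot st \<and> (\<forall>s\<in>T. Inv s \<and> final s) \<and>
      (\<forall>A. con A st \<longrightarrow> (\<exists>s\<in>T. con A s))"
  using assms(2)
proof (induction "sz st" arbitrary: st rule: less_induct)
  case less
  show ?case
  proof (cases "final st")
    case True
    with less.prems show ?thesis by (intro exI[of _ "{st}"]) auto
  next
    case False
    from step[OF less.prems False] obtain st0 st1 where st:
      "Inv st0" "Inv st1" "sz st0 < sz st" "sz st1 < sz st" "pot st0 \<le> pot st" "pot st1 < pot st"
      "\<And>A. con A st \<Longrightarrow> con A st0 \<or> con A st1" by blast
    obtain T0 where T0: "finite T0" "card T0 \<le> (sz st0 + 1) ^ pot st0"
      "\<forall>s\<in>T0. Inv s \<and> final s" "\<forall>A. con A st0 \<longrightarrow> (\<exists>s\<in>T0. con A s)"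
      using less.hyps[OF st(3,1)] by blast
    obtain T1 where T1: "finite T1" "card T1 \<le> (sz st1 + 1) ^ pot st1"
      "\<forall>s\<in>T1. Inv s \<and> final s" "\<forall>A. con A st1 \<longrightarrow> (\<exists>s\<in>T1. con A s)"
      using less.hyps[OF st(4,2)] by blast
    obtain p where p: "pot st = Suc p" using st(6) by (cases "pot st") auto
    \<comment> \<open>Both successors have size below \<open>n\<close>, so their bounds are powers
      of \<open>n\<close>, and \<open>n ^ Suc p + n ^ p\<close> is
      \<open>(n + 1) * n ^ p\<close>.\<close>
    define n where "n = sz st"
    have n: "n \<ge> 1" using st(3) unfolding n_def by simp
    have "(sz st0 + 1) ^ pot st0 \<le> n ^ pot st0" using st(3) n_def by (intro power_mono) auto
    also have "\<dots> \<le> n ^ Suc p" using st(5) n p by (intro power_increasing) auto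
    finally have c0: "card T0 \<le> n ^ Suc p" using T0(2) by linarith
    have "(sz st1 + 1) ^ pot st1 \<le> n ^ pot st1" using st(4) n_def by (intro power_mono) auto
    also have "\<dots> \<le> n ^ p" using st(6) n p by (intro power_increasing) auto
    finally have c1: "card T1 \<le> n ^ p" using T1(2) by linarith
    have "card (T0 \<union> T1) \<le> n ^ Suc p + n ^ p" using c0 c1 card_Un_le[of T0 T1] by linarith
    also have "\<dots> = (n + 1) * n ^ p" by simp
    also have "\<dots> \<le> (n + 1) * (n + 1) ^ p" by (intro mult_le_mono power_mono) auto
    finally have "card (T0 \<union> T1) \<le> (sz st + 1) ^ pot st" unfolding p n_def by simp
    thus ?thesis using T0 T1 st(7) by (intro exI[of _ "T0 \<union> T1"]) blast
  qed
qed

lemma sum_card_incidences: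
  assumes "finite U" "finite \<B>"
  shows "(\<Sum>v\<in>U. card {B\<in>\<B>. v \<in> B}) = (\<Sum>B\<in>\<B>. card (B \<inter> U))"
proof -
  have "(\<Sum>v\<in>U. card {B\<in>\<B>. v \<in> B}) = (\<Sum>B\<in>\<B>. card {v\<in>U. v \<in> B})"
    by (rule sum_multicount_gen) (use assms in auto)
  moreover have "{v\<in>U. v \<in> B} = B \<inter> U" for B by auto
  ultimately show ?thesis by simp
qed

lemma ex_sum_average_le:
  fixes f :: "'a \<Rightarrow> real" and c :: real
  assumes "finite U" "U \<noteq> {}" "c * card U \<le> sum f U"
  shows "\<exists>x\<in>U. c \<le> f x"
proof (rule ccontr)
  assume "\<not> ?thesis"
  hence "sum f U < sum (\<lambda>_. c) U" using assms by (intro sum_strict_mono) auto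
  thus False using assms by (simp add: mult.commute)
qed

text \<open>A block is a set of \<open>b\<close> points on one line. Cutting the lines into pieces of equal size, about
  the average line intersection, bounds the effect of any single point, however unevenly the lines
  meet \<open>S\<close>.\<close>

locale block_system =
  fixes S :: "'p set" and \<B> :: "'p set set" and b q s K :: nat
  assumes fin: "finite S"
    and blockS: "B \<in> \<B> \<Longrightarrow> B \<subseteq> S" and cardB: "B \<in> \<B> \<Longrightarrow> card B = b"
    and lin: "B \<in> \<B> \<Longrightarrow> B' \<in> \<B> \<Longrightarrow> x \<in> B \<Longrightarrow> y \<in> B \<Longrightarrow> x \<in> B' \<Longrightarrow> y \<in> B' \<Longrightarrow> x \<noteq> y \<Longrightarrow> B = B'"
    and deg: "x \<in> S \<Longrightarrow> card {B\<in>\<B>. x \<in> B} \<le> q"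
    and many: "card S * q \<le> 2 * card \<B> * b"
    and b64: "64 \<le> b" and sb: "16 * s * b \<le> card S" and ub: "card S \<le> 4 * K * q * b"
    and pos: "K > 0" "q > 0" "s > 0"
begin

text \<open>If \<open>F\<close> consists of points of an arc \<open>A\<close>, then a marked block
  admits at most one further point of \<open>A\<close> outside \<open>F\<close>, since
  \<open>A\<close> has at most two points in a block.\<close>

definition marked :: "'p set \<Rightarrow> 'p set set" where
  "marked F = {B\<in>\<B>. B \<inter> F \<noteq> {}}"

lemma finB: "finite \<B>"
  using fin blockS by (intro finite_subset[of \<B> "Pow S"]) auto

lemma S_pos: "card S > 0"
proof -
  have "0 < 16 * s * b" using pos b64 by simp
  thus ?thesis using sb by linarith
qed

lemma finB': "B \<in> \<B> \<Longrightarrow> finite B"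
  using blockS fin finite_subset by blast

lemma marked_sub: "marked F \<subseteq> \<B>" unfolding marked_def by auto

lemma fin_marked: "finite (marked F)" using finB marked_sub finite_subset by blast

text \<open>\<open>U\<close> will be nearly all of \<open>S\<close>, so its incidences are
  controlled through the few points outside it.\<close>

lemma sum_outside:
  assumes U: "U \<subseteq> S" and M: "M \<subseteq> \<B>"
  shows "(\<Sum>B\<in>M. real (card (B \<inter> U))) = real (card M) * b - (\<Sum>x\<in>S - U. real (card {B\<in>M. x \<in> B}))"
proof -
  have fM: "finite M" using M finB finite_subset by blast
  have "real (card (B \<inter> U)) + real (card (B \<inter> (S - U))) = b" if "B \<in> M" for B
  proof -
    have "card ((B \<inter> U) \<union> (B \<inter> (S - U))) = card (B \<inter> U) + card (B \<inter> (S - U))"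
      using that M finB' by (intro card_Un_disjoint) auto
    moreover have "(B \<inter> U) \<union> (B \<inter> (S - U)) = B" using blockS that M by blast
    ultimately show ?thesis using cardB that M by (metis of_nat_add subsetD)
  qed
  hence "(\<Sum>B\<in>M. real (card (B \<inter> U)) + real (card (B \<inter> (S - U)))) = (\<Sum>B\<in>M. real b)"
    by (rule sum.cong[OF refl])
  moreover have "(\<Sum>x\<in>S - U. real (card {B\<in>M. x \<in> B})) = (\<Sum>B\<in>M. real (card (B \<inter> (S - U))))"
    unfolding of_nat_sum[symmetric] by (subst sum_card_incidences) (use fin fM in auto)
  ultimately show ?thesis by (simp add: sum.distrib)
qed

lemma card_marked_le:
  assumes "F \<subseteq> S" shows "card (marked F) \<le> card F * q"
proof -
  have fF: "finite F" using assms fin finite_subset by blast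
  have "marked F = (\<Union>x\<in>F. {B\<in>\<B>. x \<in> B})" unfolding marked_def by auto
  also have "card \<dots> \<le> (\<Sum>x\<in>F. card {B\<in>\<B>. x \<in> B})" by (rule card_UN_le[OF fF])
  also have "\<dots> \<le> (\<Sum>x\<in>F. q)" by (rule sum_mono) (use deg assms in auto)
  finally show ?thesis by simp
qed

text \<open>By linearity, each \<open>f\<close> in \<open>F\<close> shares at most one block with
  \<open>x\<close>. This breaks down for \<open>x\<close> in \<open>F\<close>, where
  \<open>f = x\<close> may lie in \<open>q\<close> blocks.\<close>

lemma marked_degree_le:
  assumes "F \<subseteq> S" "x \<notin> F" shows "card {B\<in>marked F. x \<in> B} \<le> card F"
proof -
  have fF: "finite F" using assms fin finite_subset by blast
  have "{B\<in>marked F. x \<in> B} = (\<Union>f\<in>F. {B\<in>\<B>. f \<in> B \<and> x \<in> B})" unfolding marked_def by auto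
  also have "card \<dots> \<le> (\<Sum>f\<in>F. card {B\<in>\<B>. f \<in> B \<and> x \<in> B})" by (rule card_UN_le[OF fF])
  also have "\<dots> \<le> (\<Sum>f\<in>F. 1)"
  proof (rule sum_mono)
    fix f assume "f \<in> F"
    hence "\<forall>B\<in>{B\<in>\<B>. f \<in> B \<and> x \<in> B}. \<forall>B'\<in>{B\<in>\<B>. f \<in> B \<and> x \<in> B}. B = B'"
      using lin assms(2) by blast
    thus "card {B\<in>\<B>. f \<in> B \<and> x \<in> B} \<le> 1" using finB card_le_Suc0_iff_eq[of "{B\<in>\<B>. f \<in> B \<and> x \<in> B}"] by simp
  qed
  finally show ?thesis by simp
qed

text \<open>\<open>U\<close> has at most the fraction \<open>1 - 1 / (256 * K)\<close> of
  \<open>S\<close>, cleared of denominators and of natural subtraction. The branching stops here;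
  before that, \<open>U\<close> misses too few points of \<open>S\<close> to affect the incidence
  counts much.\<close>

definition small :: "'p set \<Rightarrow> bool" where
  "small U \<longleftrightarrow> 256 * K * card U + card S \<le> 256 * K * card S"

lemma not_small:
  assumes "\<not> small U"
  shows "real (card S) - real (card U) < real (card S) / (256 * K)" "U \<noteq> {}"
proof -
  have "256 * K * card S < 256 * K * card U + card S" using assms unfolding small_def by simp
  hence *: "256 * real K * real (card S) < 256 * real K * real (card U) + real (card S)"
    by (metis (mono_tags, lifting) of_nat_add of_nat_less_iff of_nat_mult of_nat_numeral)
  show "real (card S) - real (card U) < real (card S) / (256 * K)"
    using * pos by (simp add: field_simps)
  show "U \<noteq> {}"
  proof
    assume "U = {}"
    hence "256 * K * card S < card S" using \<open>256 * K * card S < 256 * K * card U + card S\<close> by simp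
    moreover have "1 * card S \<le> 256 * K * card S" using pos by (intro mult_le_mono1) simp
    ultimately show False by linarith
  qed
qed

text \<open>The branching has two phases. While fewer than \<open>s\<close> points are picked, a pick marks at
  least \<open>q / 4\<close> new blocks; afterwards a pick rules out at least \<open>g\<close> points, namely those sharing a
  marked block with it.\<close>

lemma ex_rich_point:
  assumes U: "U \<subseteq> S" "\<not> small U" and F: "F \<subseteq> S" "card F < s"
  shows "\<exists>v\<in>U. q \<le> 4 * card {B\<in>\<B> - marked F. v \<in> B}"
proof -
  define u where "u = real (card S)"
  have finU: "finite U" using U fin finite_subset by blast
  have u: "u > 0" unfolding u_def using S_pos by simp
  have outs: "u - card U \<le> u / 8"
  proof -
    have "u / (256 * K) \<le> u / 8" using u pos by (intro divide_left_mono) auto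
    thus ?thesis using not_small(1)[OF U(2)] unfolding u_def by linarith
  qed
  have "(\<Sum>x\<in>S - U. real (card {B\<in>\<B>. x \<in> B})) \<le> (\<Sum>x\<in>S - U. real q)"
    by (rule sum_mono) (use deg in auto)
  also have "\<dots> = real q * (u - card U)"
    using U fin finU by (simp add: card_Diff_subset card_mono of_nat_diff u_def)
  also have "\<dots> \<le> real q * (u / 8)" using outs by (intro mult_left_mono) auto
  finally have 1: "(\<Sum>x\<in>S - U. real (card {B\<in>\<B>. x \<in> B})) \<le> real q * u / 8" by simp
  have many': "u * q / 2 \<le> real (card \<B>) * b"
  proof -
    have "real (card S * q) \<le> real (2 * card \<B> * b)" using many by (rule of_nat_mono)
    thus ?thesis unfolding u_def by simp
  qed
  \<comment> \<open>Of the \<open>q * u / 2\<close> incidences guaranteed by \<open>many\<close>, at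
    most an eighth of \<open>q * u\<close> is lost outside \<open>U\<close> and, since
    \<open>16 * s * b \<le> card S\<close>, a sixteenth to the marked blocks.\<close>
  have 2: "(\<Sum>B\<in>marked F. real (card (B \<inter> U))) \<le> real q * u / 16"
  proof -
    have "(\<Sum>B\<in>marked F. real (card (B \<inter> U))) \<le> (\<Sum>B\<in>marked F. real b)"
    proof (rule sum_mono)
      fix B assume "B \<in> marked F"
      hence "B \<in> \<B>" using marked_sub by blast
      thus "real (card (B \<inter> U)) \<le> real b" using cardB finB' by (metis Int_lower1 card_mono of_nat_mono)
    qed
    also have "\<dots> = real (card (marked F) * b)" by simp
    also have "\<dots> \<le> real ((s * q) * b)"
    proof -
      have "card (marked F) \<le> s * q"
        using card_marked_le[OF F(1)] F(2) by (meson le_trans less_imp_le mult_le_mono1)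
      thus ?thesis by (intro of_nat_mono mult_le_mono1)
    qed
    also have "\<dots> = real (16 * s * b) * q / 16" by simp
    also have "\<dots> \<le> u * q / 16" unfolding u_def using sb by (intro divide_right_mono mult_right_mono of_nat_mono) auto
    finally show ?thesis by (simp add: mult.commute)
  qed
  have "(\<Sum>B\<in>\<B> - marked F. real (card (B \<inter> U))) =
      (\<Sum>B\<in>\<B>. real (card (B \<inter> U))) - (\<Sum>B\<in>marked F. real (card (B \<inter> U)))"
    using finB marked_sub by (intro sum_diff)
  moreover have "real q * u / 2 - real q * u / 8 - real q * u / 16 \<ge> real q * u / 4"
    using u by simp
  ultimately have "real q * u / 4 \<le> (\<Sum>B\<in>\<B> - marked F. real (card (B \<inter> U)))"
    using sum_outside[OF U(1) subset_refl] 1 2 many' by (simp add: mult.commute)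
  also have "\<dots> = (\<Sum>v\<in>U. real (card {B\<in>\<B> - marked F. v \<in> B}))"
    unfolding of_nat_sum[symmetric]
    by (subst sum_card_incidences[OF finU]) (use finB in auto)
  finally have *: "real q * u / 4 \<le> (\<Sum>v\<in>U. real (card {B\<in>\<B> - marked F. v \<in> B}))" .
  have "real q / 4 * card U \<le> real q * u / 4"
    unfolding u_def using U fin by (simp add: card_mono mult_left_mono)
  hence "real q / 4 * card U \<le> (\<Sum>v\<in>U. real (card {B\<in>\<B> - marked F. v \<in> B}))" using * by linarith
  from ex_sum_average_le[OF finU not_small(2)[OF U(2)] this]
  obtain v where "v \<in> U" "real q / 4 \<le> real (card {B\<in>\<B> - marked F. v \<in> B})" by blast
  thus ?thesis by (intro bexI[of _ v]) auto
qed

text \<open>Average over \<open>w\<close> the ordered pairs of points of \<open>U\<close> in a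
  common marked block. At least \<open>s * q / 4\<close> marked blocks carry
  \<open>b\<^sup>2 / 2\<close> or more such pairs on average, and
  \<open>card U \<le> 4 * K * q * b\<close>; the quotient is
  \<open>b * s / (32 * K)\<close>.\<close>

lemma ex_killing_point:
  assumes U: "U \<subseteq> S" "\<not> small U" and F: "F \<subseteq> S" "card F = s"
    and mk: "q * card F \<le> 4 * card (marked F)"
    and g: "32 * K * g \<le> b * s"
  shows "\<exists>w\<in>U. g \<le> card (U \<inter> (\<Union>{B\<in>marked F. w \<in> B} - {w}))"
proof -
  define u where "u = real (card S)"
  define M where "M = marked F"
  define \<mu> where "\<mu> = real (card M)"
  define \<beta> where "\<beta> = (\<lambda>B. real (card (B \<inter> U)))"
  define kill where "kill = (\<lambda>w. U \<inter> (\<Union>{B\<in>M. w \<in> B} - {w}))"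
  have finU: "finite U" using U fin finite_subset by blast
  have finF: "finite F" using F fin finite_subset by blast
  have MB: "M \<subseteq> \<B>" unfolding M_def by (rule marked_sub)
  have finM: "finite M" unfolding M_def by (rule fin_marked)
  have u: "u > 0" unfolding u_def using S_pos by simp
  have K: "real K > 0" and q: "real q > 0" and s: "real s > 0" and b: "real b \<ge> 64" using pos b64 by auto
  have mu1: "real s * real q \<le> 4 * \<mu>"
    using mk F(2) unfolding \<mu>_def M_def by (metis mult.commute of_nat_le_iff of_nat_mult of_nat_numeral)
  have ub': "u \<le> 4 * real K * real q * real b"
    using ub unfolding u_def by (metis of_nat_le_iff of_nat_mult of_nat_numeral)
  \<comment> \<open>A point of \<open>F\<close> can lie in \<open>q\<close> marked blocks, but there
    are only \<open>s\<close> such points; every other point lies in at most \<open>s\<close> marked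
    blocks.\<close>
  have "(\<Sum>x\<in>S - U. real (card {B\<in>M. x \<in> B})) \<le> (\<Sum>x\<in>S - U. (if x \<in> F then real q else 0) + real s)"
  proof (rule sum_mono)
    fix x assume x: "x \<in> S - U"
    show "real (card {B\<in>M. x \<in> B}) \<le> (if x \<in> F then real q else 0) + real s"
    proof (cases "x \<in> F")
      case True
      have "card {B\<in>M. x \<in> B} \<le> card {B\<in>\<B>. x \<in> B}" using MB finB by (intro card_mono) auto
      thus ?thesis using True deg[of x] x by simp
    next
      case False
      thus ?thesis using marked_degree_le[OF F(1) False] F(2) unfolding M_def by simp
    qed
  qed
  also have "\<dots> = (\<Sum>x\<in>S - U. if x \<in> F then real q else 0) + real s * (u - card U)"
    using U fin finU by (simp add: sum.distrib card_Diff_subset card_mono of_nat_diff u_def)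
  also have "\<dots> \<le> real s * real q + real s * (u / (256 * K))"
  proof (rule add_mono)
    have "(\<Sum>x\<in>S - U. if x \<in> F then real q else 0) = (\<Sum>x\<in>(S - U) \<inter> F. real q)"
      using fin by (intro sum.inter_restrict[symmetric]) auto
    also have "\<dots> \<le> real s * real q"
      using F(2) finF card_mono[of F "(S - U) \<inter> F"] by (simp add: mult_right_mono)
    finally show "(\<Sum>x\<in>S - U. if x \<in> F then real q else 0) \<le> real s * real q" .
    show "real s * (u - card U) \<le> real s * (u / (256 * K))"
      using not_small(1)[OF U(2)] unfolding u_def by (intro mult_left_mono) auto
  qed
  \<comment> \<open>Each summand is at most \<open>\<mu> * b / 16\<close>, the first by
    \<open>64 \<le> b\<close>, the second by the factor 256 in \<open>small\<close>, both through
    \<open>s * q \<le> 4 * \<mu>\<close>.\<close>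
  also have "\<dots> \<le> \<mu> * b / 8"
  proof -
    have "real s * (u / (256 * K)) \<le> real s * ((4 * real K * real q * real b) / (256 * K))"
      using ub' by (intro mult_left_mono divide_right_mono) auto
    also have "\<dots> = (real s * real q) * b / 64" using K by simp
    also have "\<dots> \<le> (4 * \<mu>) * b / 64" using mu1 by (intro divide_right_mono mult_right_mono) auto
    finally have "real s * (u / (256 * K)) \<le> \<mu> * b / 16" by simp
    moreover have "\<mu> * 64 \<le> \<mu> * b" using b unfolding \<mu>_def by (intro mult_left_mono) auto
    ultimately show ?thesis using mu1 by linarith
  qed
  finally have "(\<Sum>x\<in>S - U. real (card {B\<in>M. x \<in> B})) \<le> \<mu> * b / 8" .
  hence sumb: "(\<Sum>B\<in>M. \<beta> B) \<ge> 7 / 8 * (\<mu> * b)"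
    using sum_outside[OF U(1) MB] unfolding \<beta>_def \<mu>_def by linarith
  have card_kill: "real (card (kill w)) = (\<Sum>B\<in>{B\<in>M. w \<in> B}. \<beta> B - 1)" if w: "w \<in> U" for w
  proof -
    have "kill w = (\<Union>B\<in>{B\<in>M. w \<in> B}. B \<inter> U - {w})" unfolding kill_def by auto
    also have "card \<dots> = (\<Sum>B\<in>{B\<in>M. w \<in> B}. card (B \<inter> U - {w}))"
    proof (rule card_UN_disjoint)
      show "\<forall>i\<in>{B \<in> M. w \<in> B}. \<forall>j\<in>{B \<in> M. w \<in> B}. i \<noteq> j \<longrightarrow> (i \<inter> U - {w}) \<inter> (j \<inter> U - {w}) = {}"
        using lin MB by blast
    qed (use finM finU in auto)
    finally have "real (card (kill w)) = (\<Sum>B\<in>{B\<in>M. w \<in> B}. real (card (B \<inter> U - {w})))" by simp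
    also have "\<dots> = (\<Sum>B\<in>{B\<in>M. w \<in> B}. \<beta> B - 1)"
    proof (rule sum.cong[OF refl])
      fix B assume "B \<in> {B\<in>M. w \<in> B}"
      hence "w \<in> B \<inter> U" using w by simp
      thus "real (card (B \<inter> U - {w})) = \<beta> B - 1" using finU unfolding \<beta>_def
        by (simp add: card_Diff_singleton) (metis IntI One_nat_def Suc_leI card_gt_0_iff empty_iff finite_Int of_nat_1 of_nat_diff)
    qed
    finally show ?thesis .
  qed
  have "(\<Sum>w\<in>U. real (card (kill w))) = (\<Sum>w\<in>U. \<Sum>B\<in>{B\<in>M. w \<in> B}. \<beta> B - 1)"
    by (rule sum.cong[OF refl card_kill])
  also have "\<dots> = (\<Sum>B\<in>M. \<Sum>w\<in>{w\<in>U. w \<in> B}. \<beta> B - 1)"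
    by (rule sum.swap_restrict[OF finU finM])
  also have "\<dots> = (\<Sum>B\<in>M. \<beta> B * (\<beta> B - 1))"
  proof (rule sum.cong[OF refl])
    fix B
    have "{w\<in>U. w \<in> B} = B \<inter> U" by auto
    thus "(\<Sum>w\<in>{w\<in>U. w \<in> B}. \<beta> B - 1) = \<beta> B * (\<beta> B - 1)" unfolding \<beta>_def by simp
  qed
  also have "\<dots> \<ge> (\<Sum>B\<in>M. (real b - 1) * \<beta> B - real b ^ 2 / 4)"
  proof (rule sum_mono)
    fix B
    \<comment> \<open>The tangent to the square at \<open>b / 2\<close> makes the bound linear in
      \<open>\<beta> B\<close>; the remaining \<open>441 / 512 - 1 / 4\<close> still exceeds one
      half.\<close>
    have "0 \<le> (\<beta> B - real b / 2) ^ 2" by simp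
    thus "(real b - 1) * \<beta> B - real b ^ 2 / 4 \<le> \<beta> B * (\<beta> B - 1)"
      by (simp add: power2_eq_square algebra_simps)
  qed
  finally have k1: "(\<Sum>w\<in>U. real (card (kill w))) \<ge> (real b - 1) * (\<Sum>B\<in>M. \<beta> B) - \<mu> * (real b ^ 2 / 4)"
    by (simp add: sum_subtractf sum_distrib_left \<mu>_def)
  have "(real b - 1) * (\<Sum>B\<in>M. \<beta> B) \<ge> (63 / 64 * real b) * (7 / 8 * (\<mu> * b))"
    using sumb b by (intro mult_mono) (auto simp: \<mu>_def)
  also have "(63 / 64 * real b) * (7 / 8 * (\<mu> * b)) = 441 / 512 * (\<mu> * real b ^ 2)"
    by (simp add: power2_eq_square)
  finally have k2: "(real b - 1) * (\<Sum>B\<in>M. \<beta> B) \<ge> 441 / 512 * (\<mu> * real b ^ 2)" .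
  have "0 \<le> \<mu> * real b ^ 2" unfolding \<mu>_def by simp
  hence k3: "(\<Sum>w\<in>U. real (card (kill w))) \<ge> \<mu> * real b ^ 2 / 2" using k1 k2 by simp
  have "real g * card U \<le> real g * (4 * real K * real q * real b)"
  proof -
    have "card U \<le> u" unfolding u_def using U fin by (simp add: card_mono)
    thus ?thesis using ub' by (intro mult_left_mono) auto
  qed
  also have "\<dots> = (32 * real K * real g) * (real q * real b) / 8" by simp
  also have "\<dots> \<le> (real b * real s) * (real q * real b) / 8"
  proof -
    have "32 * real K * real g \<le> real b * real s"
      using g by (metis of_nat_le_iff of_nat_mult of_nat_numeral)
    thus ?thesis by (intro divide_right_mono mult_right_mono) auto
  qed
  also have "\<dots> = (real s * real q) * real b ^ 2 / 8" by (simp add: power2_eq_square)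
  also have "\<dots> \<le> (4 * \<mu>) * real b ^ 2 / 8" using mu1 by (intro divide_right_mono mult_right_mono) auto
  finally have "real g * card U \<le> (\<Sum>w\<in>U. real (card (kill w)))" using k3 by simp
  from ex_sum_average_le[OF finU not_small(2)[OF U(2)] this]
  show ?thesis unfolding kill_def M_def by auto
qed

text \<open>In a state \<open>(F, G, U)\<close>, the points of \<open>F\<close> and \<open>G\<close> are the picks of the two phases and \<open>U\<close>
  contains the points that are still undecided.\<close>

lemma shrinking_cover:
  assumes g: "32 * K * g \<le> b * s" "g > 0"
  shows "\<exists>\<T>. finite \<T> \<and> card \<T> \<le> (card S + 1) ^ (s + card S div g) \<and>
    (\<forall>(T, U)\<in>\<T>. T \<subseteq> S \<and> U \<subseteq> S \<and> card T \<le> s + card S div g \<and> small U) \<and>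
    (\<forall>A\<subseteq>S. (\<forall>B\<in>\<B>. card (A \<inter> B) \<le> 2) \<longrightarrow> (\<exists>(T, U)\<in>\<T>. A \<subseteq> T \<union> U))"
proof -
  define P where "P = s + card S div g"
  \<comment> \<open>The picks still available: the rest of the first phase, and one for every
    \<open>g\<close> points of \<open>U\<close>. The initial value is \<open>P\<close>.\<close>
  define pot where "pot = (\<lambda>(F, G::'p set, U::'p set). (s - card (F::'p set)) + card U div g)"
  define Inv where "Inv = (\<lambda>(F, G, U). F \<subseteq> S \<and> G \<subseteq> S \<and> U \<subseteq> S \<and> F \<inter> U = {} \<and> card F \<le> s \<and>
     q * card F \<le> 4 * card (marked F) \<and> card F + card G + pot (F, G, U) \<le> P)"
  \<comment> \<open>Only \<open>F\<close> has to lie inside \<open>A\<close>, since the exclusion in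
    the second phase combines a point of \<open>F\<close> with the current pick; the points of
    \<open>G\<close> merely belong to the cover.\<close>
  define con where "con = (\<lambda>A (F, G, U). A \<subseteq> S \<and> (\<forall>B\<in>\<B>. card (A \<inter> B) \<le> 2) \<and> F \<subseteq> A \<and> A \<subseteq> F \<union> G \<union> U)"
  have "\<exists>st0 st1. Inv st0 \<and> Inv st1 \<and>
      card (snd (snd st0)) < card (snd (snd st)) \<and> card (snd (snd st1)) < card (snd (snd st)) \<and>
      pot st0 \<le> pot st \<and> pot st1 < pot st \<and>
      (\<forall>A. con A st \<longrightarrow> con A st0 \<or> con A st1)"
    if Inv: "Inv st" and nf: "\<not> small (snd (snd st))" for st
  proof -
    obtain F G U where st: "st = (F, G, U)" by (cases st)
    have I: "F \<subseteq> S" "G \<subseteq> S" "U \<subseteq> S" "F \<inter> U = {}" "card F \<le> s" "q * card F \<le> 4 * card (marked F)"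
      "card F + card G + pot (F, G, U) \<le> P" using Inv unfolding st Inv_def by auto
    have nf: "\<not> small U" using nf st by simp
    have finU: "finite U" "finite F" "finite G" using I fin finite_subset by blast+
    have out: "Inv (F, G, U - {v}) \<and> card (U - {v}) < card U \<and> pot (F, G, U - {v}) \<le> pot (F, G, U)
      \<and> (\<forall>A. con A (F, G, U) \<and> v \<notin> A \<longrightarrow> con A (F, G, U - {v}))" if v: "v \<in> U" for v
    proof -
      have lt: "card (U - {v}) < card U" using v finU by (intro psubset_card_mono) auto
      hence "pot (F, G, U - {v}) \<le> pot (F, G, U)" unfolding pot_def by (auto intro: div_le_mono)
      thus ?thesis using lt I unfolding Inv_def con_def by auto
    qed
    show ?thesis
    proof (cases "card F < s")
      case True
      obtain v where v: "v \<in> U" "q \<le> 4 * card {B\<in>\<B> - marked F. v \<in> B}"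
        using ex_rich_point[OF I(3) nf I(1) True] by blast
      let ?st1 = "(insert v F, G, U - {v})"
      have vF: "v \<notin> F" using v I by auto
      have "marked (insert v F) = marked F \<union> {B\<in>\<B> - marked F. v \<in> B}" unfolding marked_def by auto
      hence "card (marked (insert v F)) = card (marked F) + card {B\<in>\<B> - marked F. v \<in> B}"
        using finB fin_marked by (simp add: card_Un_disjoint disjoint_iff)
      hence mk: "q * card (insert v F) \<le> 4 * card (marked (insert v F))"
        using v(2) I(6) vF finU by (simp add: algebra_simps)
      have "pot (F, G, U - {v}) \<le> pot (F, G, U)" using out[OF v(1)] by blast
      hence pot: "pot ?st1 + 1 \<le> pot (F, G, U)" using True vF finU unfolding pot_def by auto
      have "Inv ?st1" unfolding Inv_def using I mk pot True vF v(1) finU by auto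
      moreover have "\<forall>A. con A (F, G, U) \<longrightarrow> con A (F, G, U - {v}) \<or> con A ?st1"
      proof (intro allI impI)
        fix A assume A: "con A (F, G, U)"
        show "con A (F, G, U - {v}) \<or> con A ?st1"
          using A out[OF v(1)] unfolding con_def by (cases "v \<in> A") auto
      qed
      ultimately show ?thesis using out[OF v(1)] pot unfolding st
        by (intro exI[of _ "(F, G, U - {v})"] exI[of _ ?st1]) auto
    next
      case False
      hence Fs: "card F = s" using I by simp
      obtain w where w: "w \<in> U" "g \<le> card (U \<inter> (\<Union>{B\<in>marked F. w \<in> B} - {w}))"
        using ex_killing_point[OF I(3) nf I(1) Fs I(6) g(1)] by blast
      define W where "W = U \<inter> (\<Union>{B\<in>marked F. w \<in> B} - {w})"
      let ?st1 = "(F, insert w G, U - {w} - W)"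
      have "card (U - {w} - W) \<le> card (U - W)" using finU by (intro card_mono) auto
      also have "\<dots> = card U - card W" using finU unfolding W_def by (intro card_Diff_subset) auto
      finally have "card (U - {w} - W) + g \<le> card U"
        using w(2) finU card_mono[of U W] unfolding W_def by simp
      hence "(card (U - {w} - W) + g) div g \<le> card U div g" by (rule div_le_mono)
      hence pot: "pot ?st1 + 1 \<le> pot (F, G, U)" using g(2) unfolding pot_def by simp
      have "card (insert w G) \<le> card G + 1" using finU by (simp add: card_insert_if)
      hence "Inv ?st1" unfolding Inv_def using I pot w(1) by auto
      moreover have "card (U - {w} - W) < card U" using w(1) finU by (intro psubset_card_mono) auto
      moreover have "\<forall>A. con A (F, G, U) \<longrightarrow> con A (F, G, U - {w}) \<or> con A ?st1"
      proof (intro allI impI)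
        fix A assume A: "con A (F, G, U)"
        show "con A (F, G, U - {w}) \<or> con A ?st1"
        proof (cases "w \<in> A")
          case True
          have "A \<inter> W = {}"
          proof (rule ccontr)
            assume "A \<inter> W \<noteq> {}"
            then obtain x B where x: "x \<in> A" "x \<in> U" "x \<noteq> w" "B \<in> marked F" "w \<in> B" "x \<in> B"
              unfolding W_def by blast
            then obtain f where f: "f \<in> F" "f \<in> B" "B \<in> \<B>" unfolding marked_def by blast
            have "f \<noteq> x" "f \<noteq> w" using f x w(1) I(4) by auto
            hence "card {f, x, w} = 3" using x by simp
            moreover have "{f, x, w} \<subseteq> A \<inter> B" using A f x True unfolding con_def by auto
            ultimately have "3 \<le> card (A \<inter> B)" using finB'[OF f(3)] by (metis card_mono finite_Int)
            thus False using A f(3) unfolding con_def by fastforce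
          qed
          thus ?thesis using A True unfolding con_def by auto
        qed (use A out[OF w(1)] in auto)
      qed
      ultimately show ?thesis using out[OF w(1)] pot unfolding st
        by (intro exI[of _ "(F, G, U - {w})"] exI[of _ ?st1]) auto
    qed
  qed
  moreover have "Inv ({}, {}, S)" unfolding Inv_def pot_def P_def by simp
  ultimately obtain T where T: "finite T"
    "card T \<le> (card (snd (snd ({}::'p set, {}::'p set, S))) + 1) ^ pot ({}, {}, S)"
    "\<And>s. s \<in> T \<Longrightarrow> Inv s \<and> small (snd (snd s))"
    "\<And>A. con A ({}, {}, S) \<Longrightarrow> (\<exists>s\<in>T. con A s)"
    using branching_cover[where Inv = Inv and final = "\<lambda>st. small (snd (snd st))"
        and sz = "\<lambda>st. card (snd (snd st))" and pot = pot and con = con and st = "({}, {}, S)"]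
    by blast
  let ?f = "\<lambda>(F, G, U). (F \<union> G, U)"
  show ?thesis
  proof (intro exI[of _ "?f ` T"] conjI)
    show "finite (?f ` T)" using T(1) by simp
    show "card (?f ` T) \<le> (card S + 1) ^ (s + card S div g)"
      using T(2) card_image_le[OF T(1), of ?f] unfolding pot_def by simp
    show "\<forall>(T, U)\<in>?f ` T. T \<subseteq> S \<and> U \<subseteq> S \<and> card T \<le> s + card S div g \<and> small U"
    proof safe
      fix F G U assume st: "(F, G, U) \<in> T"
      note * = T(3)[OF st, unfolded Inv_def]
      show "small U" using * by simp
      show "card (F \<union> G) \<le> s + card S div g" using * card_Un_le[of F G] unfolding P_def by simp
      show "x \<in> S" if "x \<in> F" for x using * that by auto
      show "x \<in> S" if "x \<in> G" for x using * that by auto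
      show "x \<in> S" if "x \<in> U" for x using * that by auto
    qed
    show "\<forall>A\<subseteq>S. (\<forall>B\<in>\<B>. card (A \<inter> B) \<le> 2) \<longrightarrow> (\<exists>(T, U)\<in>?f ` T. A \<subseteq> T \<union> U)"
    proof (intro allI impI)
      fix A assume "A \<subseteq> S" "\<forall>B\<in>\<B>. card (A \<inter> B) \<le> 2"
      hence "con A ({}, {}, S)" unfolding con_def by simp
      then obtain F G U where "(F, G, U) \<in> T" "con A (F, G, U)" using T(4) by (metis prod_cases3)
      thus "\<exists>(T, U)\<in>?f ` T. A \<subseteq> T \<union> U" unfolding con_def
        by (intro bexI[of _ "(F \<union> G, U)"]) (auto intro: rev_image_eqI)
    qed
  qed
qed

end

section \<open>Counting arcs\<close>

lemma ex_disjoint_blocks: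
  assumes "finite Z" "b > 0"
  shows "\<exists>P. finite P \<and> disjoint P \<and> (\<forall>B\<in>P. B \<subseteq> Z \<and> card B = b) \<and> card Z \<le> card P * b + b"
  using assms(1)
proof (induction "card Z" arbitrary: Z rule: less_induct)
  case less
  show ?case
  proof (cases "card Z < b")
    case True
    thus ?thesis by (intro exI[of _ "{}"]) (auto simp: disjoint_def)
  next
    case False
    then obtain B where B: "B \<subseteq> Z" "card B = b" by (meson not_less obtain_subset_with_card_n)
    have cd: "card (Z - B) + b = card Z"
      using B less.prems False by (simp add: card_Diff_subset finite_subset)
    hence "card (Z - B) < card Z" using assms(2) by linarith
    from less.hyps[OF this] obtain P where P: "finite P" "disjoint P"
      "\<forall>B'\<in>P. B' \<subseteq> Z - B \<and> card B' = b" "card (Z - B) \<le> card P * b + b"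
      using less.prems by blast
    have "B \<noteq> {}" using B assms(2) by auto
    hence "B \<notin> P" using P(3) by blast
    hence "card Z \<le> card (insert B P) * b + b" using P(1,4) cd by simp
    moreover have "disjoint (insert B P)" using P(2,3) unfolding disjoint_def by blast
    ultimately show ?thesis using P B by (intro exI[of _ "insert B P"]) auto
  qed
qed

text \<open>\<open>t ^ t / fact t\<close> is one term of the exponential series at \<open>t\<close>,
  hence at most \<open>exp t\<close>, and 3 bounds \<open>exp 1\<close>.\<close>

lemma binomial_le_power_div:
  assumes "t > 0"
  shows "real (n choose t) \<le> (3 * real n / real t) ^ t"
proof -
  have "real t ^ t / fact t \<le> exp (real t)"
  proof -
    have "(\<Sum>k\<in>{t}. real t ^ k /\<^sub>R fact k) \<le> exp (real t)"
      unfolding exp_def by (rule sum_le_suminf[OF summable_exp_generic]) auto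
    thus ?thesis by (simp add: divide_inverse mult.commute)
  qed
  also have "\<dots> = exp 1 ^ t" by (simp flip: exp_of_nat_mult)
  also have "\<dots> \<le> 3 ^ t" using exp_le by (intro power_mono) auto
  finally have f: "real t ^ t \<le> 3 ^ t * fact t" by (simp add: field_simps)
  have "real ((n choose t) * fact t) \<le> real (n ^ t)" using binomial_fact_pow of_nat_mono by blast
  hence "real (n choose t) \<le> real n ^ t / fact t" by (simp add: field_simps)
  also have "\<dots> \<le> real n ^ t * (3 ^ t / real t ^ t)"
  proof -
    have "1 / fact t \<le> 3 ^ t / real t ^ t" using f assms by (simp add: field_simps)
    hence "real n ^ t * (1 / fact t) \<le> real n ^ t * (3 ^ t / real t ^ t)" by (rule mult_left_mono) simp
    thus ?thesis by simp
  qed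
  finally show ?thesis by (simp add: power_mult_distrib power_divide mult.commute)
qed

text \<open>Lines are indexed so that empty ones can be repeated; by \<open>lin\<close>, two points
  still determine the index. Here \<open>q\<close> is the number of lines through a point, not the
  size of a line.\<close>

locale linear_system =
  fixes V :: "'p set" and I :: "'l set" and L :: "'l \<Rightarrow> 'p set" and q m :: nat
  assumes finV: "finite V" and finI: "finite I" and cardI: "card I = m"
    and LV: "i \<in> I \<Longrightarrow> L i \<subseteq> V"
    and deg: "x \<in> V \<Longrightarrow> card {i\<in>I. x \<in> L i} = q"
    and lin: "i \<in> I \<Longrightarrow> j \<in> I \<Longrightarrow> x \<in> L i \<Longrightarrow> y \<in> L i \<Longrightarrow> x \<in> L j \<Longrightarrow> y \<in> L j \<Longrightarrow> x \<noteq> y \<Longrightarrow> i = j"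
begin

definition arc :: "'p set \<Rightarrow> bool" where
  "arc A \<longleftrightarrow> A \<subseteq> V \<and> (\<forall>i\<in>I. card (A \<inter> L i) \<le> 2)"

lemma finL: "i \<in> I \<Longrightarrow> finite (L i)"
  using LV finV finite_subset by blast

lemma arc_subset: "arc A \<Longrightarrow> A' \<subseteq> A \<Longrightarrow> arc A'"
proof -
  assume A: "arc A" "A' \<subseteq> A"
  have "card (A' \<inter> L i) \<le> 2" if i: "i \<in> I" for i
  proof -
    have "card (A' \<inter> L i) \<le> card (A \<inter> L i)" using A(2) finL[OF i] by (intro card_mono) auto
    also have "\<dots> \<le> 2" using A(1) i unfolding arc_def by blast
    finally show ?thesis .
  qed
  thus "arc A'" using A unfolding arc_def by blast
qed

text \<open>Each line is cut into disjoint pieces of size \<open>b\<close> and wastes at most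
  \<open>b\<close> of its incidences, whence the error \<open>m * b\<close>. A point lies in at most
  one piece of each of its \<open>q\<close> lines.\<close>

lemma ex_blocks:
  assumes S: "S \<subseteq> V" and b: "b \<ge> 2"
  shows "\<exists>\<B>. (\<forall>B\<in>\<B>. B \<subseteq> S \<and> card B = b \<and> (\<exists>i\<in>I. B \<subseteq> L i)) \<and>
    (\<forall>B\<in>\<B>. \<forall>B'\<in>\<B>. \<forall>x y. x \<in> B \<and> y \<in> B \<and> x \<in> B' \<and> y \<in> B' \<and> x \<noteq> y \<longrightarrow> B = B') \<and>
    (\<forall>x\<in>S. card {B\<in>\<B>. x \<in> B} \<le> q) \<and> card S * q \<le> card \<B> * b + m * b"
proof -
  have finS: "finite S" using S finV finite_subset by blast
  have "\<forall>i\<in>I. \<exists>P. finite P \<and> disjoint P \<and> (\<forall>B\<in>P. B \<subseteq> S \<inter> L i \<and> card B = b) \<and>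
      card (S \<inter> L i) \<le> card P * b + b"
  proof
    fix i
    show "\<exists>P. finite P \<and> disjoint P \<and> (\<forall>B\<in>P. B \<subseteq> S \<inter> L i \<and> card B = b) \<and>
      card (S \<inter> L i) \<le> card P * b + b"
      by (rule ex_disjoint_blocks) (use b finS in auto)
  qed
  then obtain P where P: "\<And>i. i \<in> I \<Longrightarrow> finite (P i)" "\<And>i. i \<in> I \<Longrightarrow> disjoint (P i)"
    "\<And>i B. i \<in> I \<Longrightarrow> B \<in> P i \<Longrightarrow> B \<subseteq> S \<inter> L i \<and> card B = b"
    "\<And>i. i \<in> I \<Longrightarrow> card (S \<inter> L i) \<le> card (P i) * b + b"
    by metis
  define \<B> where "\<B> = (\<Union>i\<in>I. P i)"
  \<comment> \<open>Because \<open>b \<ge> 2\<close>, a block determines its line, so blocks from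
    different lines are different and their numbers add up.\<close>
  have same_line: "i = j" if ij: "i \<in> I" "j \<in> I" "B \<in> P i" "B \<in> P j" for i j B
  proof -
    have "card B = b" using P(3) ij by blast
    hence "finite B" "\<not> card B \<le> Suc 0" using b card.infinite by fastforce+
    then obtain x y where "x \<in> B" "y \<in> B" "x \<noteq> y" using card_le_Suc0_iff_eq by blast
    moreover have "B \<subseteq> L i" "B \<subseteq> L j" using P(3) ij by blast+
    ultimately show ?thesis using lin[OF ij(1,2)] by blast
  qed
  have "card \<B> = (\<Sum>i\<in>I. card (P i))" unfolding \<B>_def
    by (rule card_UN_disjoint) (use P(1) finI same_line in blast)+
  hence "card \<B> * b + m * b = (\<Sum>i\<in>I. card (P i) * b + b)"
    using cardI by (simp add: sum.distrib sum_distrib_right)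
  also have "\<dots> \<ge> (\<Sum>i\<in>I. card (L i \<inter> S))" using P(4) by (intro sum_mono) (simp add: Int_commute)
  finally have "(\<Sum>i\<in>I. card (L i \<inter> S)) \<le> card \<B> * b + m * b" .
  moreover have "(\<Sum>i\<in>I. card (L i \<inter> S)) = (\<Sum>x\<in>S. card {i\<in>I. x \<in> L i})"
  proof -
    have "(\<Sum>x\<in>S. card {i\<in>I. x \<in> L i}) = (\<Sum>i\<in>I. card {x\<in>S. x \<in> L i})"
      by (rule sum_multicount_gen) (use finS finI in auto)
    moreover have "{x\<in>S. x \<in> L i} = L i \<inter> S" for i by auto
    ultimately show ?thesis by simp
  qed
  moreover have "(\<Sum>x\<in>S. card {i\<in>I. x \<in> L i}) = card S * q"
    using deg S by (simp add: subset_iff)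
  ultimately have many: "card S * q \<le> card \<B> * b + m * b" by simp
  have degB: "card {B\<in>\<B>. x \<in> B} \<le> q" if x: "x \<in> S" for x
  proof -
    have "{B\<in>\<B>. x \<in> B} \<subseteq> (\<Union>i\<in>{i\<in>I. x \<in> L i}. {B\<in>P i. x \<in> B})" 
    proof
      fix B assume "B \<in> {B\<in>\<B>. x \<in> B}"
      then obtain i where i: "i \<in> I" "B \<in> P i" "x \<in> B" unfolding \<B>_def by blast
      hence "x \<in> L i" using P(3)[OF i(1,2)] by blast
      thus "B \<in> (\<Union>i\<in>{i\<in>I. x \<in> L i}. {B\<in>P i. x \<in> B})" using i by blast
    qed
    hence "card {B\<in>\<B>. x \<in> B} \<le> card (\<Union>i\<in>{i\<in>I. x \<in> L i}. {B\<in>P i. x \<in> B})"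
      using P(1) finI by (intro card_mono) auto
    also have "\<dots> \<le> (\<Sum>i\<in>{i\<in>I. x \<in> L i}. card {B\<in>P i. x \<in> B})"
      using finI by (intro card_UN_le) auto
    also have "\<dots> \<le> (\<Sum>i\<in>{i\<in>I. x \<in> L i}. 1)"
    proof (rule sum_mono)
      fix i assume i: "i \<in> {i\<in>I. x \<in> L i}"
      hence "\<forall>B\<in>{B\<in>P i. x \<in> B}. \<forall>B'\<in>{B\<in>P i. x \<in> B}. B = B'"
        using P(2)[of i] unfolding disjoint_def by blast
      thus "card {B\<in>P i. x \<in> B} \<le> 1"
        using P(1) i card_le_Suc0_iff_eq[of "{B\<in>P i. x \<in> B}"] by simp
    qed
    also have "\<dots> = q" using deg x S by auto
    finally show ?thesis .
  qed
  have linB: "B = B'" if B: "B \<in> \<B>" "B' \<in> \<B>" "x \<in> B" "y \<in> B" "x \<in> B'" "y \<in> B'" "x \<noteq> y" for B B' x y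
  proof -
    obtain i j where i: "i \<in> I" "B \<in> P i" and j: "j \<in> I" "B' \<in> P j" using B unfolding \<B>_def by blast
    have "B \<subseteq> L i" "B' \<subseteq> L j" using P(3)[OF i] P(3)[OF j] by blast+
    hence "i = j" using B by (intro lin[OF i(1) j(1), of x y]) auto
    hence "B \<in> P i" "B' \<in> P i" "B \<inter> B' \<noteq> {}" using i j B by auto
    thus ?thesis using P(2)[OF i(1)] unfolding disjoint_def by metis
  qed
  have "B \<subseteq> S \<and> card B = b \<and> (\<exists>i\<in>I. B \<subseteq> L i)" if B: "B \<in> \<B>" for B
  proof -
    obtain i where i: "i \<in> I" "B \<in> P i" using B unfolding \<B>_def by blast
    thus ?thesis using P(3)[OF i] by blast
  qed
  thus ?thesis using many degB by (intro exI[of _ \<B>] conjI ballI allI impI) (auto dest: linB)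
qed

text \<open>One round. \<open>J\<close> bounds the picks of both phases: \<open>s\<close>, and then
  \<open>card S div g\<close> with \<open>g\<close> at least \<open>b * s / (64 * K)\<close> and
  \<open>card S\<close> at most \<open>4 * K * q * b\<close>.\<close>

lemma arcs_shrink:
  fixes s K :: nat
  assumes S: "S \<subseteq> V" "130 * m \<le> card S * q"
    and m: "q\<^sup>2 \<le> m" "m \<le> K * q\<^sup>2" and q: "q > 0" and s: "8 * s \<le> q" "s \<ge> K" "K > 0"
    and J: "real s + 256 * real K ^ 2 * real q / real s \<le> real J"
  shows "\<exists>\<T>. finite \<T> \<and> card \<T> \<le> (card V + 1) ^ J \<and>
    (\<forall>(T, U)\<in>\<T>. T \<subseteq> V \<and> U \<subseteq> V \<and> card T \<le> J \<and> real (card U) \<le> (1 - 1 / (256 * real K)) * card S) \<and>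
    (\<forall>A. arc A \<and> A \<subseteq> S \<longrightarrow> (\<exists>(T, U)\<in>\<T>. A \<subseteq> T \<union> U))"
proof -
  define u where "u = card S"
  \<comment> \<open>Half the average intersection of a line with \<open>S\<close>: the waste
    \<open>m * b\<close> is then at most half of the \<open>card S * q\<close> incidences. The
    factor 130 in the assumption on \<open>S\<close> yields \<open>b \<ge> 65\<close>.\<close>
  define b where "b = u * q div (2 * m)"
  \<comment> \<open>The largest \<open>g\<close> that the second phase admits.\<close>
  define g where "g = b * s div (32 * K)"
  have mpos: "m > 0" using m(1) q by (metis gr0I le_zero_eq less_numeral_extra(3) power_eq_0_iff)
  have b_le: "2 * m * b \<le> u * q" unfolding b_def by simp
  have "65 * (2 * m) \<le> u * q" using S(2) unfolding u_def by simp
  hence "65 * (2 * m) div (2 * m) \<le> b" unfolding b_def by (rule div_le_mono)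
  hence b65: "b \<ge> 65" using mpos by simp
  have b_ge: "u * q \<le> 4 * m * b"
  proof -
    have "u * q < 2 * m * (b + 1)"
      unfolding b_def using mpos dividend_less_times_div[of "2 * m" "u * q"] by (simp add: algebra_simps)
    also have "\<dots> \<le> 2 * m * (2 * b)" using b65 by (intro mult_le_mono2) simp
    finally show ?thesis by (simp add: mult.assoc)
  qed
  have ub: "u \<le> 4 * K * q * b"
  proof -
    have "u * q \<le> 4 * (K * q\<^sup>2) * b" using b_ge m(2) by (meson le_trans mult_le_mono1 mult_le_mono2)
    also have "\<dots> = (4 * K * q * b) * q" by (simp add: power2_eq_square)
    finally show ?thesis using q by simp
  qed
  have sb: "16 * s * b \<le> u"
  proof -
    have "(2 * q * b) * q \<le> 2 * m * b" using m(1) by (simp add: power2_eq_square mult.commute mult.left_commute)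
    hence "(2 * q * b) * q \<le> u * q" using b_le by linarith
    hence "2 * q * b \<le> u" using q by simp
    moreover have "2 * (8 * s) * b \<le> 2 * q * b" using s by (intro mult_le_mono) auto
    moreover have "16 * s * b = 2 * (8 * s) * b" by simp
    ultimately show ?thesis by linarith
  qed
  have b2: "b \<ge> 2" using b65 by simp
  from ex_blocks[OF S(1) b2] obtain \<B> where \<B>: "\<forall>B\<in>\<B>. B \<subseteq> S \<and> card B = b \<and> (\<exists>i\<in>I. B \<subseteq> L i)"
    "\<forall>B\<in>\<B>. \<forall>B'\<in>\<B>. \<forall>x y. x \<in> B \<and> y \<in> B \<and> x \<in> B' \<and> y \<in> B' \<and> x \<noteq> y \<longrightarrow> B = B'"
    "\<forall>x\<in>S. card {B\<in>\<B>. x \<in> B} \<le> q" "card S * q \<le> card \<B> * b + m * b"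
    by (elim exE conjE)
  have "2 * (card S * q) \<le> 2 * (card \<B> * b) + u * q" using \<B>(4) b_le by simp
  hence many: "card S * q \<le> 2 * card \<B> * b" unfolding u_def mult.assoc by linarith
  have bs: "block_system S \<B> b q s K"
  proof
    show "finite S" using S finV finite_subset by blast
    show "s > 0" using s by simp
    show "B = B'" if "B \<in> \<B>" "B' \<in> \<B>" "x \<in> B" "y \<in> B" "x \<in> B'" "y \<in> B'" "x \<noteq> y" for B B' x y
      using \<B>(2) that by blast
    show "B \<subseteq> S" "card B = b" if "B \<in> \<B>" for B using \<B>(1) that by blast+
    show "card {B \<in> \<B>. x \<in> B} \<le> q" if "x \<in> S" for x using \<B>(3) that by blast
    show "64 \<le> b" using b65 by simp
  qed (fact many sb[unfolded u_def] ub[unfolded u_def] q s(3))+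
  have g1: "32 * K * g \<le> b * s" unfolding g_def by simp
  have "64 * K \<le> b * s" using b65 s by (intro mult_le_mono) auto
  hence "2 * (32 * K) div (32 * K) \<le> g" unfolding g_def by (intro div_le_mono) simp
  hence g2: "g \<ge> 2" using s by simp
  have g3: "b * s \<le> 64 * K * g"
  proof -
    have "b * s < 32 * K * (g + 1)"
      unfolding g_def using s dividend_less_times_div[of "32 * K" "b * s"] by (simp add: algebra_simps)
    also have "\<dots> \<le> 32 * K * (2 * g)" using g2 by (intro mult_le_mono2) simp
    finally show ?thesis by (simp add: mult.assoc)
  qed
  have "u div g \<le> J - s"
  proof -
    have "real (u div g) \<le> real u / real g" by (rule of_nat_div_le_of_nat)
    also have "\<dots> \<le> 256 * real K ^ 2 * real q / real s"
    proof -
      have "u * s \<le> 4 * K * q * (b * s)" using ub by (metis mult.assoc mult_le_mono1)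
      also have "\<dots> \<le> 4 * K * q * (64 * K * g)" by (intro mult_le_mono2 g3)
      also have "\<dots> = 256 * K\<^sup>2 * q * g" by (simp add: power2_eq_square)
      finally have "real u * real s \<le> 256 * real K ^ 2 * real q * real g"
        by (metis (mono_tags, lifting) of_nat_le_iff of_nat_mult of_nat_numeral of_nat_power)
      thus ?thesis using g2 s by (simp add: field_simps)
    qed
    finally have "real s + real (u div g) \<le> real J" using J by linarith
    thus ?thesis by linarith
  qed
  moreover have "s \<le> J"
  proof -
    have "0 \<le> 256 * real K ^ 2 * real q / real s" by simp
    thus ?thesis using J by linarith
  qed
  ultimately have PJ: "s + u div g \<le> J" by simp
  have "g > 0" using g2 by simp
  from block_system.shrinking_cover[OF bs g1 this] obtain \<T>
    where \<T>: "finite \<T>" "card \<T> \<le> (u + 1) ^ (s + u div g)"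
    "\<forall>(T, U)\<in>\<T>. T \<subseteq> S \<and> U \<subseteq> S \<and> card T \<le> s + u div g \<and> block_system.small S K U"
    "\<forall>A\<subseteq>S. (\<forall>B\<in>\<B>. card (A \<inter> B) \<le> 2) \<longrightarrow> (\<exists>(T, U)\<in>\<T>. A \<subseteq> T \<union> U)"
    unfolding u_def by (elim exE conjE)
  show ?thesis
  proof (intro exI[of _ \<T>] conjI)
    have "(u + 1) ^ (s + u div g) \<le> (card V + 1) ^ (s + u div g)"
      unfolding u_def using S finV by (intro power_mono) (auto intro: card_mono)
    also have "\<dots> \<le> (card V + 1) ^ J" using PJ by (intro power_increasing) auto
    finally show "card \<T> \<le> (card V + 1) ^ J" using \<T>(2) by linarith
    have "real (card U) \<le> (1 - 1 / (256 * real K)) * card S" if "block_system.small S K U" for U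
    proof -
      have "256 * K * card U + card S \<le> 256 * K * card S"
        using that unfolding block_system.small_def[OF bs] .
      hence "256 * real K * real (card U) + real (card S) \<le> 256 * real K * real (card S)"
        by (metis (mono_tags, lifting) of_nat_add of_nat_le_iff of_nat_mult of_nat_numeral)
      thus ?thesis using s by (simp add: field_simps)
    qed
    thus "\<forall>(T, U)\<in>\<T>. T \<subseteq> V \<and> U \<subseteq> V \<and> card T \<le> J \<and> real (card U) \<le> (1 - 1 / (256 * real K)) * card S"
      using \<T>(3) S PJ by fastforce
    show "\<forall>A. arc A \<and> A \<subseteq> S \<longrightarrow> (\<exists>(T, U)\<in>\<T>. A \<subseteq> T \<union> U)"
    proof (intro allI impI)
      fix A assume A: "arc A \<and> A \<subseteq> S"
      have "card (A \<inter> B) \<le> 2" if B: "B \<in> \<B>" for B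
      proof -
        obtain i where i: "i \<in> I" "B \<subseteq> L i" using \<B>(1) B by blast
        have "card (A \<inter> B) \<le> card (A \<inter> L i)" using i finL by (intro card_mono) auto
        thus ?thesis using A i unfolding arc_def by (meson le_trans)
      qed
      thus "\<exists>(T, U)\<in>\<T>. A \<subseteq> T \<union> U" using \<T>(4) A by blast
    qed
  qed (rule \<T>(1))
qed

text \<open>The round is iterated inside each container; one with at most \<open>130 * m / q\<close>
  points is kept as it is. \<open>T\<close> collects the picks of all rounds and gains at most
  \<open>J\<close> points in each.\<close>

lemma arcs_cover:
  fixes s K J R :: nat
  assumes m: "q\<^sup>2 \<le> m" "m \<le> K * q\<^sup>2" and q: "q > 0" and s: "8 * s \<le> q" "s \<ge> K" "K > 0"
    and J: "real s + 256 * real K ^ 2 * real q / real s \<le> real J"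
  shows "\<exists>\<T>. finite \<T> \<and> card \<T> \<le> ((card V + 1) ^ J) ^ R \<and>
    (\<forall>(T, U)\<in>\<T>. T \<subseteq> V \<and> U \<subseteq> V \<and> card T \<le> R * J \<and>
       (card U * q \<le> 130 * m \<or> real (card U) \<le> (1 - 1 / (256 * real K)) ^ R * card V)) \<and>
    (\<forall>A. arc A \<longrightarrow> (\<exists>(T, U)\<in>\<T>. A \<subseteq> T \<union> U))"
proof (induction R)
  case 0
  show ?case by (intro exI[of _ "{({}, V)}"]) (auto simp: arc_def)
next
  case (Suc R)
  let ?M = "(card V + 1) ^ J" and ?d = "1 - 1 / (256 * real K)"
  have d0: "?d \<ge> 0" using s by simp
  from Suc.IH obtain \<T> where fT: "finite \<T>" "card \<T> \<le> ?M ^ R"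
    and T': "\<forall>(T, U)\<in>\<T>. T \<subseteq> V \<and> U \<subseteq> V \<and> card T \<le> R * J \<and>
       (card U * q \<le> 130 * m \<or> real (card U) \<le> ?d ^ R * card V)"
    "\<forall>A. arc A \<longrightarrow> (\<exists>(T, U)\<in>\<T>. A \<subseteq> T \<union> U)"
    by (elim exE conjE)
  have \<T>: "finite \<T>" "card \<T> \<le> ?M ^ R"
    "\<And>T U. (T, U) \<in> \<T> \<Longrightarrow> T \<subseteq> V \<and> U \<subseteq> V \<and> card T \<le> R * J \<and>
       (card U * q \<le> 130 * m \<or> real (card U) \<le> ?d ^ R * card V)"
    "\<And>A. arc A \<Longrightarrow> \<exists>(T, U)\<in>\<T>. A \<subseteq> T \<union> U"
    using fT T' by blast+
  define Q where "Q = (\<lambda>p \<T>'. finite \<T>' \<and> card \<T>' \<le> ?M \<and>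
     (\<forall>(T', U')\<in>\<T>'. T' \<subseteq> V \<and> U' \<subseteq> V \<and> card T' \<le> J \<and>
         (card U' * q \<le> 130 * m \<or> real (card U') \<le> ?d ^ Suc R * card V)) \<and>
     (\<forall>A. arc A \<and> A \<subseteq> snd (p :: 'p set \<times> 'p set) \<longrightarrow> (\<exists>(T', U')\<in>\<T>'. A \<subseteq> T' \<union> U')))"
  have "\<exists>\<T>'. Q p \<T>'" if p: "p \<in> \<T>" for p
  proof (cases "card (snd p) * q \<le> 130 * m")
    case True
    have "snd p \<subseteq> V" using \<T>(3) p by (metis prod.collapse)
    thus ?thesis using True unfolding Q_def by (intro exI[of _ "{({}, snd p)}"]) (auto simp del: power_Suc)
  next
    case False
    have 1: "snd p \<subseteq> V" "real (card (snd p)) \<le> ?d ^ R * card V"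
      using \<T>(3)[of "fst p" "snd p"] p False by auto
    obtain \<T>' where \<T>': "finite \<T>'" "card \<T>' \<le> ?M"
      "\<forall>(T, U)\<in>\<T>'. T \<subseteq> V \<and> U \<subseteq> V \<and> card T \<le> J \<and> real (card U) \<le> ?d * card (snd p)"
      "\<forall>A. arc A \<and> A \<subseteq> snd p \<longrightarrow> (\<exists>(T, U)\<in>\<T>'. A \<subseteq> T \<union> U)"
      using arcs_shrink[OF 1(1) _ m q s J] False by auto
    have "?d * card (snd p) \<le> ?d ^ Suc R * card V"
      using mult_left_mono[OF 1(2) d0] by (simp add: mult.assoc)
    thus ?thesis using \<T>' unfolding Q_def by (intro exI[of _ \<T>']) fastforce
  qed
  then obtain f where Qf: "\<And>p. p \<in> \<T> \<Longrightarrow> Q p (f p)" by metis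
  have f: "finite (f p)" "card (f p) \<le> ?M" if "p \<in> \<T>" for p
    using Qf[OF that] unfolding Q_def by blast+
  have fU: "T' \<subseteq> V \<and> U' \<subseteq> V \<and> card T' \<le> J \<and>
      (card U' * q \<le> 130 * m \<or> real (card U') \<le> ?d ^ Suc R * card V)"
    if "p \<in> \<T>" "(T', U') \<in> f p" for p T' U'
    using Qf[OF that(1)] that(2) unfolding Q_def by blast
  have fA: "\<exists>(T', U')\<in>f p. A \<subseteq> T' \<union> U'" if "p \<in> \<T>" "arc A" "A \<subseteq> snd p" for p A
    using Qf[OF that(1)] that(2,3) unfolding Q_def by blast
  define \<T>2 where "\<T>2 = (\<Union>p\<in>\<T>. (\<lambda>(T', U'). (fst p \<union> T', U')) ` f p)"
  show ?case
  proof (intro exI[of _ \<T>2] conjI)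
    show "finite \<T>2" unfolding \<T>2_def using \<T>(1) f(1) by blast
    have "card \<T>2 \<le> (\<Sum>p\<in>\<T>. card ((\<lambda>(T', U'). (fst p \<union> T', U')) ` f p))"
      unfolding \<T>2_def by (rule card_UN_le[OF \<T>(1)])
    also have "\<dots> \<le> (\<Sum>p\<in>\<T>. ?M)"
      by (rule sum_mono) (use f(1,2) card_image_le le_trans in blast)
    also have "\<dots> \<le> ?M ^ R * ?M" using \<T>(2) by (simp add: mult_le_mono1)
    finally show "card \<T>2 \<le> ?M ^ Suc R" by (simp add: mult.commute)
    show "\<forall>(T, U)\<in>\<T>2. T \<subseteq> V \<and> U \<subseteq> V \<and> card T \<le> Suc R * J \<and>
       (card U * q \<le> 130 * m \<or> real (card U) \<le> ?d ^ Suc R * card V)"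
    proof (intro ballI, clarify)
      fix T U assume "(T, U) \<in> \<T>2"
      then obtain p T' where p: "p \<in> \<T>" "(T', U) \<in> f p" "T = fst p \<union> T'" unfolding \<T>2_def by auto
      note 1 = fU[OF p(1,2)] and 2 = \<T>(3)[of "fst p" "snd p"]
      show "T \<subseteq> V \<and> U \<subseteq> V \<and> card T \<le> Suc R * J \<and>
       (card U * q \<le> 130 * m \<or> real (card U) \<le> ?d ^ Suc R * card V)"
        using 1 2 p card_Un_le[of "fst p" T'] by auto
    qed
    show "\<forall>A. arc A \<longrightarrow> (\<exists>(T, U)\<in>\<T>2. A \<subseteq> T \<union> U)"
    proof (intro allI impI)
      fix A assume A: "arc A"
      from \<T>(4)[OF A] obtain T U where TU: "(T, U) \<in> \<T>" "A \<subseteq> T \<union> U" by blast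
      have "arc (A \<inter> U)" using arc_subset[OF A] by blast
      from fA[OF TU(1) this] obtain T' U' where "(T', U') \<in> f (T, U)" "A \<inter> U \<subseteq> T' \<union> U'" by auto
      thus "\<exists>(T, U)\<in>\<T>2. A \<subseteq> T \<union> U" using TU unfolding \<T>2_def
        by (intro bexI[of _ "(T \<union> T', U')"]) force+
    qed
  qed
qed

text \<open>\<open>Z\<close> dominates both possible container sizes, so all containers get the same
  bound on their \<open>t\<close>-subsets.\<close>

lemma card_arcs_le:
  fixes s K J R :: nat
  assumes "q\<^sup>2 \<le> m" "m \<le> K * q\<^sup>2" and q: "q > 0" and "8 * s \<le> q" "s \<ge> K" "K > 0"
    and "real s + 256 * real K ^ 2 * real q / real s \<le> real J"
    and Z: "130 * real m / real q \<le> Z" "(1 - 1 / (256 * real K)) ^ R * card V \<le> Z"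
    and t: "t > 0"
  shows "real (card {A. arc A \<and> card A = t}) \<le> real ((card V + 1) ^ (J * R)) * (3 * (real (R * J) + Z) / real t) ^ t"
proof -
  define c where "c = (3 * (real (R * J) + Z) / real t) ^ t"
  from arcs_cover[OF assms(1-7), of R] obtain \<T>
    where fT: "finite \<T>" "card \<T> \<le> ((card V + 1) ^ J) ^ R"
    and T': "\<forall>(T, U)\<in>\<T>. T \<subseteq> V \<and> U \<subseteq> V \<and> card T \<le> R * J \<and>
       (card U * q \<le> 130 * m \<or> real (card U) \<le> (1 - 1 / (256 * real K)) ^ R * card V)"
    "\<forall>A. arc A \<longrightarrow> (\<exists>(T, U)\<in>\<T>. A \<subseteq> T \<union> U)"
    by (elim exE conjE)
  have \<T>: "finite \<T>" "card \<T> \<le> ((card V + 1) ^ J) ^ R"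
    "\<And>T U. (T, U) \<in> \<T> \<Longrightarrow> T \<subseteq> V \<and> U \<subseteq> V \<and> card T \<le> R * J \<and>
       (card U * q \<le> 130 * m \<or> real (card U) \<le> (1 - 1 / (256 * real K)) ^ R * card V)"
    "\<And>A. arc A \<Longrightarrow> \<exists>(T, U)\<in>\<T>. A \<subseteq> T \<union> U"
    using fT T' by blast+
  let ?W = "\<lambda>p. {A. A \<subseteq> fst p \<union> snd p \<and> card A = t}"
  have fin: "finite (fst p \<union> snd p)" if "p \<in> \<T>" for p
    using \<T>(3)[of "fst p" "snd p"] that finV by (metis finite_Un finite_subset prod.collapse)
  have "card {A. arc A \<and> card A = t} \<le> card (\<Union>p\<in>\<T>. ?W p)"
    using \<T>(1,4) fin by (intro card_mono) fastforce+
  also have "\<dots> \<le> (\<Sum>p\<in>\<T>. card (?W p))" by (rule card_UN_le[OF \<T>(1)])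
  finally have "real (card {A. arc A \<and> card A = t}) \<le> (\<Sum>p\<in>\<T>. real (card (?W p)))"
    unfolding of_nat_sum[symmetric] by (rule of_nat_mono)
  also have "\<dots> \<le> (\<Sum>p\<in>\<T>. c)"
  proof (rule sum_mono)
    fix p assume p: "p \<in> \<T>"
    let ?z = "card (fst p \<union> snd p)"
    note 1 = \<T>(3)[of "fst p" "snd p"]
    have "real (card (snd p)) \<le> Z"
    proof (cases "card (snd p) * q \<le> 130 * m")
      case True
      hence "real (card (snd p)) * real q \<le> 130 * real m"
        by (metis of_nat_le_iff of_nat_mult of_nat_numeral)
      hence "real (card (snd p)) \<le> 130 * real m / real q" using q by (simp add: field_simps)
      thus ?thesis using Z by linarith
    next
      case False
      thus ?thesis using 1 p Z(2) by auto
    qed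
    moreover have "card (fst p) \<le> R * J" using 1 p by simp
    ultimately have z: "real ?z \<le> real (R * J) + Z" using card_Un_le[of "fst p" "snd p"] by linarith
    have "card (?W p) = (?z choose t)" using n_subsets[OF fin[OF p]] by simp
    also have "real \<dots> \<le> (3 * real ?z / real t) ^ t" by (rule binomial_le_power_div[OF t])
    also have "\<dots> \<le> c" unfolding c_def using z by (intro power_mono divide_right_mono) auto
    finally show "real (card (?W p)) \<le> c" .
  qed
  also have "\<dots> = real (card \<T>) * c" by simp
  also have "\<dots> \<le> real (((card V + 1) ^ J) ^ R) * c"
  proof (rule mult_right_mono)
    have "0 \<le> 130 * real m / real q" by simp
    hence "0 \<le> Z" using Z by linarith
    thus "0 \<le> c" unfolding c_def by simp
  qed (use \<T>(2) of_nat_mono in blast)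
  finally show ?thesis unfolding c_def by (simp only: power_mult)
qed

end

section \<open>Sampling from affine planes\<close>

text \<open>Divided by \<open>N choose n\<close>: a uniform \<open>n\<close>-subset contains a given
  \<open>w\<close>-subset with probability at most \<open>(n / N) ^ w\<close>, since every factor
  \<open>(n - i) / (N - i)\<close> is at most \<open>n / N\<close>.\<close>

lemma binomial_diff_le:
  assumes "n \<le> N" "w \<le> n"
  shows "real (N - w choose (n - w)) \<le> real (N choose n) * (real n / real N) ^ w"
  using assms(2)
proof (induction w)
  case (Suc w)
  define a b where "a = N - Suc w" and "b = n - Suc w"
  have ab: "N - w = Suc a" "n - w = Suc b" using Suc.prems assms(1) unfolding a_def b_def by auto
  have "Suc a * (a choose b) = (Suc a choose Suc b) * Suc b" by (rule Suc_times_binomial_eq)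
  hence "real (Suc a) * real (a choose b) = real (Suc a choose Suc b) * real (Suc b)"
    by (metis of_nat_mult)
  hence 1: "real (a choose b) = real (Suc a choose Suc b) * (real (Suc b) / real (Suc a))"
    by (simp add: field_simps)
  have "real (Suc b) / real (Suc a) \<le> real n / real N"
  proof -
    have "real (Suc b) = real n - real w" "real (Suc a) = real N - real w"
      using ab Suc.prems assms(1) by linarith+
    moreover have "(real n - real w) * real N \<le> real n * (real N - real w)"
      using assms(1) by (simp add: algebra_simps mult_right_mono)
    moreover have "real N - real w > 0" "real N > 0" using Suc.prems assms(1) by linarith+
    ultimately show ?thesis by (simp add: divide_simps mult.commute)
  qed
  hence "real (a choose b) \<le> real (Suc a choose Suc b) * (real n / real N)"
    unfolding 1 by (rule mult_left_mono) simp
  also have "\<dots> \<le> (real (N choose n) * (real n / real N) ^ w) * (real n / real N)"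
    using Suc ab by (intro mult_right_mono) auto
  finally show ?case unfolding a_def b_def by (simp add: mult.commute mult.left_commute)
qed simp

text \<open>The union bound, for a uniform subset of exactly \<open>n\<close> points: its size needs
  no concentration estimate.\<close>

lemma ex_subset_avoiding:
  assumes V: "finite V" "n \<le> card V" and W: "\<And>W. W \<in> \<W> \<Longrightarrow> W \<subseteq> V"
    and less1: "(\<Sum>W\<in>\<W>. (real n / real (card V)) ^ card W) < 1"
  shows "\<exists>X\<subseteq>V. card X = n \<and> (\<forall>W\<in>\<W>. \<not> W \<subseteq> X)"
proof (rule ccontr)
  assume no: "\<not> ?thesis"
  let ?N = "card V" and ?X = "\<lambda>W. {X. X \<subseteq> V \<and> card X = n \<and> W \<subseteq> X}"
  have finW: "finite \<W>" using W V(1) by (intro finite_subset[of \<W> "Pow V"]) auto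
  have Xle: "real (card (?X W)) \<le> real (?N choose n) * (real n / real ?N) ^ card W" if "W \<in> \<W>" for W
  proof (cases "card W \<le> n")
    case True
    have fW: "finite W" "W \<subseteq> V" using W that V(1) finite_subset by blast+
    let ?Y = "{Y. Y \<subseteq> V - W \<and> card Y = n - card W}"
    have "?X W \<subseteq> (\<lambda>Y. Y \<union> W) ` ?Y"
    proof
      fix X assume X: "X \<in> ?X W"
      hence "X - W \<in> ?Y" using fW by (auto simp: card_Diff_subset)
      moreover have "X = (X - W) \<union> W" using X by auto
      ultimately show "X \<in> (\<lambda>Y. Y \<union> W) ` ?Y" by blast
    qed
    hence "card (?X W) \<le> card ?Y"
      using V(1) by (intro surj_card_le) auto
    also have "card ?Y = (?N - card W choose (n - card W))"
      using V(1) fW by (simp add: n_subsets card_Diff_subset)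
    finally show ?thesis using binomial_diff_le[OF V(2) True] by linarith
  next
    case False
    have "?X W = {}"
    proof (rule ccontr)
      assume "?X W \<noteq> {}"
      then obtain X where X: "X \<subseteq> V" "card X = n" "W \<subseteq> X" by blast
      hence "card W \<le> n" using V(1) card_mono finite_subset by metis
      thus False using False by simp
    qed
    thus ?thesis by (simp only: card.empty) simp
  qed
  have "{X. X \<subseteq> V \<and> card X = n} \<subseteq> (\<Union>W\<in>\<W>. ?X W)" using no by blast
  hence "card {X. X \<subseteq> V \<and> card X = n} \<le> card (\<Union>W\<in>\<W>. ?X W)"
    using V(1) finW by (intro card_mono) auto
  also have "\<dots> \<le> (\<Sum>W\<in>\<W>. card (?X W))" by (rule card_UN_le[OF finW])
  finally have le: "card {X. X \<subseteq> V \<and> card X = n} \<le> (\<Sum>W\<in>\<W>. card (?X W))" .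
  have "real (?N choose n) = real (card {X. X \<subseteq> V \<and> card X = n})"
    using n_subsets[OF V(1), of n] by simp
  also have "\<dots> \<le> real (\<Sum>W\<in>\<W>. card (?X W))" using le by (rule of_nat_mono)
  also have "\<dots> = (\<Sum>W\<in>\<W>. real (card (?X W)))" by (rule of_nat_sum)
  also have "\<dots> \<le> (\<Sum>W\<in>\<W>. real (?N choose n) * (real n / real ?N) ^ card W)"
    by (rule sum_mono[OF Xle])
  also have "\<dots> = real (?N choose n) * (\<Sum>W\<in>\<W>. (real n / real ?N) ^ card W)"
    by (simp add: sum_distrib_left)
  also have "\<dots> < real (?N choose n) * 1" using less1 V(2) by (intro mult_strict_left_mono) auto
  finally show False by simp
qed

text \<open>The triple \<open>(c, x, y)\<close> is the point \<open>(x, y)\<close> of the affine plane with index \<open>c < k\<close> over the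
  integers modulo \<open>q\<close>, and \<open>(c, a, d)\<close> is its line \<open>y = a x + d\<close>. With several planes it suffices
  that \<open>q\<^sup>2\<close> has the order of \<open>m\<close>, whereas \<open>q\<^sup>2 = (1 + o(1)) m\<close> would require the prime number
  theorem. The lines with index \<open>k\<close> are empty and pad the number of lines to exactly \<open>m\<close>.\<close>

definition plane_points :: "nat \<Rightarrow> nat \<Rightarrow> (nat \<times> nat \<times> nat) set" where
  "plane_points k q = {..<k} \<times> {..<q} \<times> {..<q}"

definition plane_lines :: "nat \<Rightarrow> nat \<Rightarrow> nat \<Rightarrow> (nat \<times> nat \<times> nat) set" where
  "plane_lines k q m = plane_points k q \<union> {k} \<times> {0} \<times> {..<m - k * q\<^sup>2}"

fun plane_line :: "nat \<Rightarrow> nat \<Rightarrow> nat \<times> nat \<times> nat \<Rightarrow> (nat \<times> nat \<times> nat) set" where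
  "plane_line k q (c, a, d) = (if c < k then (\<lambda>x. (c, x, (a * x + d) mod q)) ` {..<q} else {})"

lemma card_plane_points: "card (plane_points k q) = k * q\<^sup>2"
  unfolding plane_points_def by (simp add: power2_eq_square)

lemma card_plane_line_le: "card (plane_line k q i) \<le> q"
proof -
  obtain c a d where "i = (c, a, d)" by (cases i)
  thus ?thesis using card_image_le[of "{..<q}" "\<lambda>x. (c, x, (a * x + d) mod q)"] by simp
qed

text \<open>There are no vertical lines, so a point has exactly one line for each of the
  \<open>q\<close> slopes, and distinct points of a line differ in \<open>x\<close>. Subtracting the
  equations of two common lines gives \<open>q dvd (a - a') * (x - x')\<close>, where primality
  applies.\<close>

lemma plane_linear_system:
  assumes q: "prime q" and m: "k * q\<^sup>2 \<le> m"
  shows "linear_system (plane_points k q) (plane_lines k q m) (plane_line k q) q m"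
proof
  have q0: "q > 0" using q by (simp add: prime_gt_0_nat)
  show "finite (plane_points k q)" "finite (plane_lines k q m)"
    unfolding plane_points_def plane_lines_def by auto
  have "card (plane_lines k q m) = card (plane_points k q) + card ({k} \<times> {0::nat} \<times> {..<m - k * q\<^sup>2})"
    unfolding plane_lines_def by (rule card_Un_disjoint) (auto simp: plane_points_def)
  thus "card (plane_lines k q m) = m" using m by (simp add: card_plane_points card_cartesian_product)
  show "plane_line k q i \<subseteq> plane_points k q" for i
    using q0 by (cases i) (auto simp: plane_points_def)
  show "card {i \<in> plane_lines k q m. p \<in> plane_line k q i} = q" if p: "p \<in> plane_points k q" for p
  proof -
    obtain c x y where pc: "p = (c, x, y)" by (cases p)
    have c: "c < k" "x < q" "y < q" using p pc unfolding plane_points_def by auto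
    \<comment> \<open>The intercept of the line of slope \<open>a\<close> through
      \<open>p\<close>.\<close>
    define f where "f = (\<lambda>a. nat ((int y - int a * int x) mod int q))"
    have f: "(a * x + d) mod q = y \<longleftrightarrow> d = f a" if d: "d < q" for a d
    proof -
      have "(a * x + d) mod q = y \<longleftrightarrow> [a * x + d = y] (mod q)"
        using c by (simp add: Cong.cong_def)
      also have "\<dots> \<longleftrightarrow> [int (a * x + d) = int y] (mod int q)" by (rule cong_int_iff[symmetric])
      also have "\<dots> \<longleftrightarrow> [int a * int x + int d = int y] (mod int q)" by simp
      also have "\<dots> \<longleftrightarrow> [int d = int y - int a * int x] (mod int q)"
        by (simp add: cong_iff_dvd_diff algebra_simps)
      also have "\<dots> \<longleftrightarrow> int d = (int y - int a * int x) mod int q"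
        using d by (simp add: Cong.cong_def)
      also have "\<dots> \<longleftrightarrow> d = f a" unfolding f_def using q0 by auto
      finally show ?thesis .
    qed
    have fq: "f a < q" for a
      unfolding f_def using q0 by (simp add: nat_less_iff)
    have "{i \<in> plane_lines k q m. p \<in> plane_line k q i} = (\<lambda>a. (c, a, f a)) ` {..<q}"
    proof (intro equalityI subsetI)
      fix i assume i: "i \<in> {i \<in> plane_lines k q m. p \<in> plane_line k q i}"
      obtain c' a d where ic: "i = (c', a, d)" by (cases i)
      have *: "c' = c" "(a * x + d) mod q = y" using i c unfolding ic pc by (auto split: if_splits)
      have "a < q" "d < q" using i c(1) *(1) unfolding ic plane_lines_def plane_points_def by auto
      thus "i \<in> (\<lambda>a. (c, a, f a)) ` {..<q}" using * f unfolding ic by auto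
    next
      fix i assume "i \<in> (\<lambda>a. (c, a, f a)) ` {..<q}"
      then obtain a where a: "i = (c, a, f a)" "a < q" by blast
      have "(a * x + f a) mod q = y" using f[OF fq, of a a] by simp
      thus "i \<in> {i \<in> plane_lines k q m. p \<in> plane_line k q i}"
        using a c fq[of a] unfolding pc plane_lines_def plane_points_def by (auto intro!: image_eqI[of _ _ x])
    qed
    also have "card \<dots> = q" by (subst card_image) (auto simp: inj_on_def)
    finally show ?thesis .
  qed
  show "i = j" if i: "i \<in> plane_lines k q m" "j \<in> plane_lines k q m"
    and p: "p \<in> plane_line k q i" "p' \<in> plane_line k q i" "p \<in> plane_line k q j" "p' \<in> plane_line k q j" "p \<noteq> p'"
    for i j p p'
  proof -
    obtain c a d where ic: "i = (c, a, d)" by (cases i)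
    obtain c' a' d' where jc: "j = (c', a', d')" by (cases j)
    obtain x where x: "p = (c, x, (a * x + d) mod q)" "x < q" "c < k" using p(1) unfolding ic by (auto split: if_splits)
    obtain x' where x': "p' = (c, x', (a * x' + d) mod q)" "x' < q" using p(2) unfolding ic by (auto split: if_splits)
    have c': "c' = c" using p(3) x(1) unfolding jc by (auto split: if_splits)
    have e1: "(a * x + d) mod q = (a' * x + d') mod q" using p(3) x unfolding jc by (auto split: if_splits)
    have e2: "(a * x' + d) mod q = (a' * x' + d') mod q" using p(4) x' unfolding jc by (auto split: if_splits)
    have lt: "a < q" "d < q" "a' < q" "d' < q"
      using i x(3) unfolding ic jc c' plane_lines_def plane_points_def by auto
    have xx: "x \<noteq> x'" using p(5) x x' by auto
    have small: "u = v" if "u < q" "v < q" "int q dvd int u - int v" for u v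
    proof -
      have "[int u = int v] (mod int q)" using that(3) by (simp add: cong_iff_dvd_diff)
      thus ?thesis using that(1,2) by (simp add: cong_int_iff Cong.cong_def)
    qed
    have dvd: "int q dvd int u - int v" if "u mod q = v mod q" for u v
    proof -
      have "[int u = int v] (mod int q)" unfolding cong_int_iff using that by (simp add: Cong.cong_def)
      thus ?thesis by (simp add: cong_iff_dvd_diff)
    qed
    have f1: "int q dvd (int a * int x + int d) - (int a' * int x + int d')"
      using dvd[OF e1] by simp
    have f2: "int q dvd (int a * int x' + int d) - (int a' * int x' + int d')"
      using dvd[OF e2] by simp
    have "int q dvd ((int a * int x + int d) - (int a' * int x + int d')) -
        ((int a * int x' + int d) - (int a' * int x' + int d'))" by (rule dvd_diff[OF f1 f2])
    also have "\<dots> = (int a - int a') * (int x - int x')" by (simp add: algebra_simps)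
    finally have "int q dvd int a - int a' \<or> int q dvd int x - int x'"
      using q by (simp add: prime_dvd_mult_iff)
    hence aa: "a = a'" using small lt xx x(2) x'(2) by blast
    hence "int q dvd int d - int d'" using f1 by simp
    hence "d = d'" using small lt by blast
    thus ?thesis using ic jc c' aa by simp
  qed
qed

section \<open>The incidence graph\<close>

text \<open>Points become even and lines odd numbers, which keeps the two sides disjoint. A 4-cycle
  would consist of two points on two common lines.\<close>

lemma ex_bipartite_graph_of_incidence:
  fixes X :: "'p::countable set" and I :: "'l::countable set" and L :: "'l \<Rightarrow> 'p set"
  assumes X: "finite X" and I: "finite I"
    and lin: "\<forall>i j x y. i \<in> I \<longrightarrow> j \<in> I \<longrightarrow> x \<in> L i \<longrightarrow> y \<in> L i \<longrightarrow> x \<in> L j \<longrightarrow> y \<in> L j \<longrightarrow> x \<noteq> y \<longrightarrow> i = j"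
  shows "\<exists>(X'::nat set) (Y::nat set) E f g. bipartite_graph X' Y E \<and> C4_free E \<and>
    X' = f ` X \<and> inj f \<and> Y = g ` I \<and> inj g \<and> (\<forall>i\<in>I. neighbourhood E (g i) = f ` (X \<inter> L i))"
proof -
  define f :: "'p \<Rightarrow> nat" where "f = (\<lambda>p. 2 * to_nat p)"
  define g :: "'l \<Rightarrow> nat" where "g = (\<lambda>i. 2 * to_nat i + 1)"
  define E where "E = {{f p, g i} | p i. p \<in> X \<and> i \<in> I \<and> p \<in> L i}"
  have inj: "inj f" "inj g" unfolding f_def g_def by (auto intro!: injI)
  have fg: "f p \<noteq> g i" for p i unfolding f_def g_def by presburger
  have edge: "{a, b} \<in> E \<longleftrightarrow> (\<exists>p i. p \<in> X \<and> i \<in> I \<and> p \<in> L i \<and> (a = f p \<and> b = g i \<or> a = g i \<and> b = f p))" for a b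
    unfolding E_def by (auto simp: doubleton_eq_iff)
  have edge1: "{f p, b} \<in> E \<longleftrightarrow> (\<exists>i. p \<in> X \<and> i \<in> I \<and> p \<in> L i \<and> b = g i)" for p b
    unfolding edge using fg inj by (auto simp: inj_eq)
  have edge2: "{g i, a} \<in> E \<longleftrightarrow> (\<exists>p. p \<in> X \<and> i \<in> I \<and> p \<in> L i \<and> a = f p)" for i a
    unfolding edge using fg[symmetric] inj by (auto simp: inj_eq)
  have no: False if h: "distinct [f p, b, c, d]" "{f p, b} \<in> E" "{b, c} \<in> E" "{c, d} \<in> E" "{d, f p} \<in> E" for p b c d
  proof -
    obtain i where i: "p \<in> X" "i \<in> I" "p \<in> L i" "b = g i" using h(2) edge1 by blast
    obtain p' where p': "p' \<in> L i" "c = f p'" using h(3) unfolding i(4) edge2 by blast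
    obtain j where j: "j \<in> I" "p' \<in> L j" "d = g j" using h(4) unfolding p'(2) edge1 by blast
    have "p \<in> L j" using h(5) unfolding j(3) edge2 using inj(1) by (auto simp: inj_eq)
    moreover have "p \<noteq> p'" "i \<noteq> j" using h(1) i p' j by auto
    ultimately show False using lin i p' j by blast
  qed
  have "C4_free E"
    unfolding C4_free_def
  proof safe
    fix a b c d
    assume C: "distinct [a, b, c, d]" "{a, b} \<in> E" "{b, c} \<in> E" "{c, d} \<in> E" "{d, a} \<in> E"
    from C(2) consider p where "a = f p" | p where "b = f p" unfolding edge by blast
    thus False
    proof cases
      case 1
      show False by (rule no[of p b c d]) (use C 1 in auto)
    next
      case 2
      show False by (rule no[of p c d a]) (use C 2 in auto)
    qed
  qed
  moreover have "bipartite_graph (f ` X) (g ` I) E"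
    unfolding bipartite_graph_def E_def using X I fg by auto
  moreover have "neighbourhood E (g i) = f ` (X \<inter> L i)" if "i \<in> I" for i
    unfolding neighbourhood_def using that by (auto simp: insert_commute[of _ "g i"] edge2)
  ultimately show ?thesis using inj by blast
qed

section \<open>Choice of parameters and the union bound\<close>

lemma ex_prime_sqrt_scale:
  fixes m :: nat
  assumes m: "m \<ge> 2 ^ 60"
  shows "\<exists>q. prime q \<and> 4 * q\<^sup>2 \<le> m \<and> m \<le> 1024 * q\<^sup>2"
proof -
  \<comment> \<open>A prime square between \<open>16 ^ j\<close> and \<open>16 ^ (j + 1)\<close> is
    then at most \<open>m / 4\<close> and at least \<open>m / 1024\<close>, as
    \<open>1024 = 4 * 16\<^sup>2\<close>. The factor 4 ensures that rounding \<open>m\<close> down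
    to a multiple of \<open>q\<^sup>2\<close> loses at most a quarter of it.\<close>
  have "\<exists>j. (4::nat) * 16 ^ (j + 1) \<le> m \<and> m < 4 * 16 ^ (j + 2)"
  proof -
    define P where "P = (\<lambda>j. m < (4::nat) * 16 ^ (j + 1))"
    have ex: "P m" unfolding P_def using power_gt_expt[of 16 "m + 1"] by simp
    have "\<not> P 0" unfolding P_def using m by simp
    then obtain j where "\<not> P j" "P (Suc j)" using ex_least_nat_less[of P m] ex by blast
    thus ?thesis unfolding P_def by (auto simp: not_less)
  qed
  then obtain j where j: "(4::nat) * 16 ^ (j + 1) \<le> m" "m < 4 * 16 ^ (j + 2)" by blast
  have "j \<ge> 4"
  proof (rule ccontr)
    assume "\<not> j \<ge> 4"
    hence "(16::nat) ^ (j + 2) \<le> 16 ^ 6" by (intro power_increasing) auto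
    thus False using j(2) m by simp
  qed
  from prime_between_powers_of_4[OF this] obtain q :: nat where q: "prime q" "4 ^ j < q" "q \<le> 4 ^ (j + 1)" by blast
  have p16: "((4::nat) ^ n)\<^sup>2 = 16 ^ n" for n by (simp add: power2_eq_square flip: power_mult_distrib)
  have "q\<^sup>2 \<le> (4 ^ (j + 1))\<^sup>2" using q(3) by (intro power_mono) auto
  moreover have "(4 ^ j)\<^sup>2 \<le> q\<^sup>2" using q(2) by (intro power_mono) auto
  ultimately have "q\<^sup>2 \<le> 16 ^ (j + 1)" "16 ^ j \<le> q\<^sup>2" unfolding p16 by auto
  thus ?thesis using j q(1) by (intro exI[of _ q]) auto
qed

text \<open>With \<open>w = m powr (1 / 4)\<close>, the prime satisfies \<open>w\<^sup>2 / 32 \<le> q \<le> w\<^sup>2 / 2\<close>, and a sample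
  of \<open>w ^ 3 * l\<^sup>2 / 2\<close> points has density \<open>p \<le> l\<^sup>2 / w\<close>.\<close>

lemma ex_sparse_arc_sample:
  fixes m :: nat and w l :: real
  assumes m: "m \<ge> 2 ^ 60" and w: "w > 0" "w ^ 4 = real m" and l: "l = ln (real m)"
    and big: "2 ^ 48 * l \<le> w" "4 \<le> w ^ 3 * l\<^sup>2" "l\<^sup>2 \<le> w"
  shows "\<exists>I L (X :: (nat \<times> nat \<times> nat) set).
    finite X \<and> finite I \<and> card I = m \<and>
    (\<forall>i j x y. i \<in> I \<longrightarrow> j \<in> I \<longrightarrow> x \<in> L i \<longrightarrow> y \<in> L i \<longrightarrow> x \<in> L j \<longrightarrow> y \<in> L j \<longrightarrow> x \<noteq> y \<longrightarrow> i = (j :: nat \<times> nat \<times> nat)) \<and>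
    1 / 2 * w ^ 3 * l\<^sup>2 \<le> real (card X) \<and>
    (\<forall>i\<in>I. real (card (X \<inter> L i)) \<le> 2 * w * l\<^sup>2) \<and>
    (\<forall>X'\<subseteq>X. 2 ^ 50 * w * l\<^sup>2 \<le> real (card X') \<longrightarrow> (\<exists>i\<in>I. card (X' \<inter> L i) \<ge> 3))"
proof -
  obtain q where q: "prime q" "4 * q\<^sup>2 \<le> m" "m \<le> 1024 * q\<^sup>2" using ex_prime_sqrt_scale[OF m] by blast
  have q0: "q > 0" using q(1) by (simp add: prime_gt_0_nat)
  have m0: "real m > 0" using m by simp
  have m1: "real m \<ge> 1" using m by simp
  have l4: "l \<ge> 4"
  proof -
    have "exp (4::real) = exp 1 ^ 4" by (simp flip: exp_of_nat_mult)
    also have "\<dots> \<le> 3 ^ 4" using exp_le by (intro power_mono) auto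
    also have "\<dots> \<le> real m" using m by simp
    finally show ?thesis unfolding l using m0 by (simp add: ln_ge_iff)
  qed
  have w1: "w \<ge> 1" using big(1) l4 by simp
  have qm: "q\<^sup>2 \<le> m" using q(2) by simp
  have q_up: "2 * real q \<le> w\<^sup>2"
  proof -
    have "real (4 * q\<^sup>2) \<le> w ^ 4" unfolding w(2) using q(2) by (rule of_nat_mono)
    hence "(2 * real q)\<^sup>2 \<le> (w\<^sup>2)\<^sup>2" by (simp add: power_mult_distrib)
    thus ?thesis by (rule power2_le_imp_le) simp
  qed
  have q_lo: "w\<^sup>2 \<le> 32 * real q"
  proof -
    have "w ^ 4 \<le> real (1024 * q\<^sup>2)" unfolding w(2) using q(3) by (rule of_nat_mono)
    hence "(w\<^sup>2)\<^sup>2 \<le> (32 * real q)\<^sup>2" by (simp add: power_mult_distrib)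
    thus ?thesis by (rule power2_le_imp_le) simp
  qed
  have q_big: "2 ^ 24 \<le> q"
  proof (rule ccontr)
    assume "\<not> ?thesis"
    hence "q\<^sup>2 \<le> (2 ^ 24)\<^sup>2" by (intro power_mono) auto
    thus False using q(3) m by simp
  qed
  define k where "k = m div q\<^sup>2"
  define V where "V = plane_points k q"
  define I where "I = plane_lines k q m"
  define L where "L = plane_line k q"
  have km: "k * q\<^sup>2 \<le> m" unfolding k_def by simp
  interpret linear_system V I L q m
    unfolding V_def I_def L_def by (rule plane_linear_system[OF q(1) km])
  define N where "N = card V"
  have Nm: "N \<le> m" unfolding N_def V_def card_plane_points by (rule km)
  have "m < N + q\<^sup>2"
    unfolding N_def V_def card_plane_points k_def using q0 dividend_less_div_times[of "q\<^sup>2" m] by simp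
  hence "3 * m \<le> 4 * N" using q(2) by linarith
  hence N34: "3 / 4 * real m \<le> real N" by linarith
  \<comment> \<open>This balances \<open>s\<close> against \<open>q / s\<close> up to constants and
    makes \<open>J\<close> of order at most \<open>w\<close>.\<close>
  define s where "s = nat \<lceil>sqrt (real q)\<rceil>"
  have s1: "sqrt (real q) \<le> real s" unfolding s_def by linarith
  have s2: "real s \<le> sqrt (real q) + 1" unfolding s_def using real_sqrt_ge_zero[of "real q"] by linarith
  have sq12: "sqrt (real q) \<ge> 2 ^ 12"
  proof (rule real_le_rsqrt)
    have "(2 ^ 24 :: real) \<le> real q" using q_big by (metis of_nat_le_iff of_nat_numeral of_nat_power)
    thus "(2 ^ 12)\<^sup>2 \<le> real q" by simp
  qed
  have sK: "1024 \<le> s"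
  proof -
    have "real 1024 \<le> real s" using s1 sq12 by simp
    thus ?thesis by linarith
  qed
  have s8: "8 * s \<le> q"
  proof -
    have "8 * real s \<le> 2 ^ 12 * sqrt (real q)" using s2 sq12 by simp
    also have "\<dots> \<le> sqrt (real q) * sqrt (real q)" using sq12 by (intro mult_right_mono) auto
    finally have "real (8 * s) \<le> real q" by simp
    thus ?thesis by linarith
  qed
  have sqw: "sqrt (real q) \<le> w"
  proof (rule real_le_lsqrt)
    show "real q \<le> w\<^sup>2" using q_up by linarith
  qed (use w in auto)
  define J where "J = nat \<lceil>real s + 256 * real 1024 ^ 2 * real q / real s\<rceil>"
  have J1: "real s + 256 * real 1024 ^ 2 * real q / real s \<le> real J" unfolding J_def by linarith
  have J2: "real J \<le> 2 ^ 29 * w"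
  proof -
    have "real q / real s \<le> real q / sqrt (real q)" using s1 q0 sK by (intro divide_left_mono) auto
    also have "\<dots> = sqrt (real q)" using q0 by (simp add: real_div_sqrt)
    finally have "256 * real 1024 ^ 2 * (real q / real s) \<le> 2 ^ 28 * sqrt (real q)" by simp
    moreover have "real J \<le> real s + 256 * real 1024 ^ 2 * real q / real s + 1"
    proof -
      have "0 \<le> real s + 256 * real 1024 ^ 2 * real q / real s" by simp
      thus ?thesis unfolding J_def by linarith
    qed
    ultimately have "real J \<le> 2 ^ 29 * sqrt (real q)" using s2 sq12 by simp
    thus ?thesis using sqw by simp
  qed
  \<comment> \<open>\<open>2 ^ 18\<close> is \<open>256 * 1024\<close>, so after \<open>R\<close>
    rounds the shrinking factor is at most \<open>exp (- l) = 1 / m\<close>, which brings even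
    \<open>card V\<close> down to 1.\<close>
  define R where "R = nat \<lceil>2 ^ 18 * l\<rceil>"
  have R1: "2 ^ 18 * l \<le> real R" unfolding R_def by linarith
  have R2: "real R \<le> 2 ^ 19 * l"
  proof -
    have "0 \<le> 2 ^ 18 * l" using l4 by simp
    hence "real R \<le> 2 ^ 18 * l + 1" unfolding R_def by linarith
    thus ?thesis using l4 by simp
  qed
  have RJ: "real R * real J \<le> 2 ^ 48 * (w * l)"
  proof -
    have "real R * real J \<le> (2 ^ 19 * l) * (2 ^ 29 * w)" using R2 J2 l4 by (intro mult_mono) auto
    thus ?thesis by (simp add: mult.commute)
  qed
  \<comment> \<open>\<open>4160 = 130 * 32\<close>, from
    \<open>w\<^sup>2 \<le> 32 * q\<close>.\<close>
  define Z where "Z = 4160 * w\<^sup>2"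
  have Z1: "130 * real m / real q \<le> Z"
  proof -
    have "130 * real m = 130 * (w\<^sup>2 * w\<^sup>2)" using w(2) by (simp flip: power_add)
    also have "\<dots> \<le> 130 * (w\<^sup>2 * (32 * real q))" using q_lo by (intro mult_left_mono) auto
    finally show ?thesis unfolding Z_def using q0 by (simp add: divide_simps)
  qed
  have Z2: "(1 - 1 / (256 * real 1024)) ^ R * real (card V) \<le> Z"
  proof -
    have "1 - 1 / (256 * real 1024) \<le> exp (- (1 / 2 ^ 18))"
      using exp_ge_add_one_self[of "- (1 / 2 ^ 18 :: real)"] by simp
    hence "(1 - 1 / (256 * real 1024)) ^ R \<le> exp (- (1 / 2 ^ 18)) ^ R" by (intro power_mono) auto
    also have "\<dots> = exp (- (real R / 2 ^ 18))" by (simp flip: exp_of_nat_mult)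
    also have "\<dots> \<le> exp (- l)" using R1 by simp
    also have "\<dots> = 1 / real m" unfolding l using m0 by (simp add: exp_minus inverse_eq_divide)
    finally have "(1 - 1 / (256 * real 1024)) ^ R * real (card V) \<le> 1 / real m * real m"
      using Nm unfolding N_def by (intro mult_mono) auto
    also have "\<dots> = 1" using m0 by simp
    also have "1 \<le> Z" unfolding Z_def using one_le_power[OF w1, of 2] by linarith
    finally show ?thesis .
  qed
  have wl: "1 \<le> w * l\<^sup>2"
    using mult_mono[of 1 w 1 "l\<^sup>2"] w1 l4 one_le_power[of l 2] by simp
  \<comment> \<open>At least twice the exponent \<open>2 ^ 49 * (w * l\<^sup>2)\<close> in the bound
    on the number of containers.\<close>
  define t where "t = nat \<lceil>2 ^ 50 * (w * l\<^sup>2)\<rceil>"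
  have t1: "2 ^ 50 * (w * l\<^sup>2) \<le> real t" unfolding t_def by linarith
  have t0: "t > 0"
  proof -
    have "0 < 2 ^ 50 * (w * l\<^sup>2)" using wl by simp
    hence "0 < real t" using t1 by linarith
    thus ?thesis by simp
  qed
  \<comment> \<open>\<open>4 \<le> w ^ 3 * l\<^sup>2\<close> absorbs the rounding into a factor
    \<open>3 / 4\<close>, which cancels against \<open>N \<ge> 3 / 4 * m\<close> in the
    density.\<close>
  define n where "n = nat \<lceil>1 / 2 * (w ^ 3 * l\<^sup>2)\<rceil>"
  have n1: "1 / 2 * (w ^ 3 * l\<^sup>2) \<le> real n" unfolding n_def by linarith
  have n2: "real n \<le> 3 / 4 * (w ^ 3 * l\<^sup>2)" unfolding n_def using big(2) by linarith
  define p where "p = real n / real N"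
  have N0: "real N > 0" using N34 m0 by linarith
  have p0: "p \<ge> 0" unfolding p_def by simp
  have p1: "w * p \<le> l\<^sup>2"
  proof -
    have "w * real n \<le> w * (3 / 4 * (w ^ 3 * l\<^sup>2))" using n2 w by (intro mult_left_mono) auto
    also have "\<dots> = (3 / 4 * real m) * l\<^sup>2" unfolding w(2)[symmetric] by (simp add: eval_nat_numeral)
    also have "\<dots> \<le> real N * l\<^sup>2" using N34 by (intro mult_right_mono) auto
    finally show ?thesis unfolding p_def using N0 by (simp add: field_simps)
  qed
  have nN: "n \<le> N"
  proof -
    have "w * p \<le> w * 1" using p1 big(3) by linarith
    hence "p \<le> 1" using w by (simp only: mult_le_cancel_left_pos)
    thus ?thesis unfolding p_def using N0 by (simp add: field_simps)
  qed
  \<comment> \<open>One more than the largest integer within the degree bound, so that avoiding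
    \<open>r\<close> points on a line gives the bound without loss.\<close>
  define r where "r = nat \<lfloor>2 * (w * l\<^sup>2)\<rfloor> + 1"
  have r1: "2 * (w * l\<^sup>2) \<le> real r" unfolding r_def by linarith
  have r0: "r > 0" unfolding r_def by simp
  define \<W>1 where "\<W>1 = (\<Union>i\<in>I. {W. W \<subseteq> L i \<and> card W = r})"
  define \<W>2 where "\<W>2 = {A. arc A \<and> card A = t}"
  have sum1: "(\<Sum>W\<in>\<W>1. p ^ card W) \<le> 1 / 4"
  proof -
    have "(\<Sum>W\<in>\<W>1. p ^ card W) = real (card \<W>1) * p ^ r" unfolding \<W>1_def by simp
    also have "real (card \<W>1) \<le> real m * (3 * real q / real r) ^ r"
    proof -
      have "card \<W>1 \<le> (\<Sum>i\<in>I. card {W. W \<subseteq> L i \<and> card W = r})"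
        unfolding \<W>1_def by (rule card_UN_le[OF finI])
      also have "\<dots> \<le> (\<Sum>i\<in>I. q choose r)"
      proof (rule sum_mono)
        fix i assume i: "i \<in> I"
        have "card {W. W \<subseteq> L i \<and> card W = r} = (card (L i) choose r)"
          by (rule n_subsets[OF finL[OF i]])
        also have "\<dots> \<le> (q choose r)" unfolding L_def by (rule binomial_right_mono[OF card_plane_line_le])
        finally show "card {W. W \<subseteq> L i \<and> card W = r} \<le> (q choose r)" .
      qed
      also have "\<dots> = m * (q choose r)" using cardI by simp
      finally have "real (card \<W>1) \<le> real m * real (q choose r)" by (metis of_nat_le_iff of_nat_mult)
      also have "\<dots> \<le> real m * (3 * real q / real r) ^ r"
        using binomial_le_power_div[OF r0] by (intro mult_left_mono) auto
      finally show ?thesis .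
    qed
    hence "real (card \<W>1) * p ^ r \<le> real m * (3 * real q / real r) ^ r * p ^ r"
      using p0 by (intro mult_right_mono) auto
    also have "\<dots> = real m * (3 * real q / real r * p) ^ r" by (simp only: power_mult_distrib mult.assoc)
    also have "\<dots> \<le> real m * (3 / 4) ^ r"
    proof -
      \<comment> \<open>A line has at most \<open>q * p \<le> w * l\<^sup>2 / 2\<close> sample
        points on average, a quarter of \<open>r\<close>; the factor 3 of the binomial bound still
        leaves a base below 1.\<close>
      have "4 * (real q * p) \<le> 2 * (w\<^sup>2 * p)" using mult_right_mono[OF q_up p0] by (simp add: mult_ac)
      also have "\<dots> = 2 * (w * (w * p))" by (simp add: power2_eq_square)
      also have "\<dots> \<le> 2 * (w * l\<^sup>2)" using p1 w by (intro mult_left_mono) auto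
      also have "\<dots> \<le> real r" by (rule r1)
      finally have "3 * real q / real r * p \<le> 3 / 4" using r0 by (simp add: field_simps)
      thus ?thesis using p0 by (intro mult_left_mono power_mono) auto
    qed
    \<comment> \<open>\<open>r / 4 \<ge> w * l\<^sup>2 / 2 \<ge> 2 * l\<close> because
      \<open>l \<ge> 4\<close>; the resulting \<open>1 / m\<^sup>2\<close> beats the number of
      lines.\<close>
    also have "\<dots> \<le> real m * exp (- (2 * l))"
    proof -
      have "3 / 4 \<le> exp (- (1 / 4 :: real))" using exp_ge_add_one_self[of "- (1 / 4 :: real)"] by simp
      hence "(3 / 4 :: real) ^ r \<le> exp (- (1 / 4)) ^ r" by (intro power_mono) auto
      also have "\<dots> = exp (- (real r / 4))" by (simp flip: exp_of_nat_mult)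
      also have "\<dots> \<le> exp (- (2 * l))"
      proof -
        have "4 * l \<le> l * l" using l4 by (intro mult_right_mono) auto
        also have "\<dots> \<le> w * l\<^sup>2" using mult_right_mono[OF w1, of "l\<^sup>2"] by (simp add: power2_eq_square)
        finally show ?thesis using r1 by simp
      qed
      finally show ?thesis by (intro mult_left_mono) auto
    qed
    also have "\<dots> = 1 / real m"
    proof -
      have "exp (- (2 * l)) = exp (- l) * exp (- l)" by (simp flip: exp_add)
      also have "exp (- l) = 1 / real m" unfolding l using m0 by (simp add: exp_minus inverse_eq_divide)
      finally show ?thesis using m0 by simp
    qed
    also have "\<dots> \<le> 1 / 4" using m by (intro divide_left_mono) auto
    finally show ?thesis using \<open>(\<Sum>W\<in>\<W>1. p ^ card W) = real (card \<W>1) * p ^ r\<close> by simp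
  qed
  have sum2: "(\<Sum>W\<in>\<W>2. p ^ card W) \<le> 1 / 2"
  proof -
    have "(\<Sum>W\<in>\<W>2. p ^ card W) = real (card \<W>2) * p ^ t" unfolding \<W>2_def by simp
    also have "\<dots> \<le> (real ((card V + 1) ^ (J * R)) * (3 * (real (R * J) + Z) / real t) ^ t) * p ^ t"
      unfolding \<W>2_def
      using card_arcs_le[OF qm q(3) q0 s8 sK _ J1 Z1 Z2 t0] p0 by (intro mult_right_mono) auto
    also have "\<dots> = real ((card V + 1) ^ (J * R)) * (3 * (real (R * J) + Z) / real t * p) ^ t"
      by (simp only: power_mult_distrib mult.assoc)
    also have "\<dots> \<le> exp (2 ^ 49 * (w * l\<^sup>2)) * exp (- real t)"
    proof (rule mult_mono)
      have "real (card V + 1) \<le> exp (2 * l)"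
      proof -
        have "real (card V + 1) \<le> real m + real m" using Nm m1 unfolding N_def by linarith
        also have "\<dots> \<le> real m * real m" using mult_right_mono[of 2 "real m" "real m"] m by simp
        also have "real m = exp l" unfolding l using m0 by simp
        also have "exp l * exp l = exp (2 * l)" by (simp only: mult_2 exp_add)
        finally show ?thesis .
      qed
      hence "real ((card V + 1) ^ (J * R)) \<le> exp (2 * l) ^ (J * R)"
        unfolding of_nat_power by (intro power_mono) auto
      also have "\<dots> = exp (2 * l * (real R * real J))" by (subst exp_of_nat_mult[symmetric]) (simp add: mult_ac)
      also have "\<dots> \<le> exp (2 * l * (2 ^ 48 * (w * l)))"
      proof -
        have "2 * l * (real R * real J) \<le> 2 * l * (2 ^ 48 * (w * l))" using RJ l4 by (intro mult_left_mono) auto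
        thus ?thesis by simp
      qed
      also have "2 * l * (2 ^ 48 * (w * l)) = 2 ^ 49 * (w * l\<^sup>2)" by (simp add: power2_eq_square)
      finally show "real ((card V + 1) ^ (J * R)) \<le> exp (2 ^ 49 * (w * l\<^sup>2))" .
      \<comment> \<open>The picks belong to the cover as well; \<open>2 ^ 48 * l \<le> w\<close>
        keeps their number at most \<open>w\<^sup>2\<close>, the order of \<open>Z\<close>.\<close>
      have "2 ^ 48 * (w * l) \<le> w\<^sup>2"
        using mult_left_mono[OF big(1), of w] w by (simp add: power2_eq_square mult_ac)
      hence "real R * real J \<le> w\<^sup>2" using RJ by linarith
      hence "real (R * J) + Z \<le> 5000 * w\<^sup>2" 
        unfolding Z_def of_nat_mult using zero_le_power2[of w] by linarith
      hence "(real (R * J) + Z) * p \<le> 5000 * w\<^sup>2 * p" using p0 by (rule mult_right_mono)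
      also have "\<dots> = 5000 * (w * (w * p))" by (simp add: power2_eq_square)
      also have "\<dots> \<le> 5000 * (w * l\<^sup>2)" using p1 w by (intro mult_left_mono) auto
      also have "\<dots> \<le> 1 / 9 * real t" using t1 wl by simp
      finally have "3 * (real (R * J) + Z) / real t * p \<le> 1 / 3" using t0 by (simp add: field_simps)
      also have "\<dots> \<le> exp (-1)" using exp_le by (simp add: exp_minus field_simps)
      finally have e: "3 * (real (R * J) + Z) / real t * p \<le> exp (-1)" .
      have "0 \<le> 3 * (real (R * J) + Z) / real t * p" using p0 unfolding Z_def by simp
      hence "(3 * (real (R * J) + Z) / real t * p) ^ t \<le> exp (-1) ^ t" using e by (intro power_mono) auto
      thus "(3 * (real (R * J) + Z) / real t * p) ^ t \<le> exp (- real t)" by (simp flip: exp_of_nat_mult)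
    qed (use p0 in \<open>auto simp: Z_def\<close>)
    also have "\<dots> = exp (2 ^ 49 * (w * l\<^sup>2) - real t)" by (simp flip: exp_add)
    also have "\<dots> \<le> exp (- 1)" using t1 wl by simp
    also have "\<dots> \<le> 1 / 2" using exp_ge_add_one_self[of "1::real"] by (simp add: exp_minus field_simps)
    finally show ?thesis .
  qed
  have fin1: "finite \<W>1" unfolding \<W>1_def using finI finL by auto
  have fin2: "finite \<W>2" unfolding \<W>2_def arc_def using finV by auto
  have "(\<Sum>W\<in>\<W>1 \<union> \<W>2. p ^ card W) \<le> (\<Sum>W\<in>\<W>1. p ^ card W) + (\<Sum>W\<in>\<W>2. p ^ card W)"
  proof -
    have "0 \<le> (\<Sum>W\<in>\<W>1 \<inter> \<W>2. p ^ card W)" using p0 by (simp add: sum_nonneg)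
    thus ?thesis using sum.union_inter[OF fin1 fin2, of "\<lambda>W. p ^ card W"] by linarith
  qed
  hence less1: "(\<Sum>W\<in>\<W>1 \<union> \<W>2. (real n / real (card V)) ^ card W) < 1"
    using sum1 sum2 unfolding p_def N_def by linarith
  have WV: "W \<subseteq> V" if "W \<in> \<W>1 \<union> \<W>2" for W
    using that LV unfolding \<W>1_def \<W>2_def arc_def by blast
  obtain X where X: "X \<subseteq> V" "card X = n" "\<And>W. W \<in> \<W>1 \<union> \<W>2 \<Longrightarrow> \<not> W \<subseteq> X"
    using ex_subset_avoiding[OF finV nN[unfolded N_def] WV less1] by blast
  have finX: "finite X" using X(1) finV finite_subset by blast
  have "real (card (X \<inter> L i)) \<le> 2 * w * l\<^sup>2" if i: "i \<in> I" for i
  proof -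
    have "card (X \<inter> L i) < r"
    proof (rule ccontr)
      assume "\<not> ?thesis"
      then obtain W where "W \<subseteq> X \<inter> L i" "card W = r" by (meson not_less obtain_subset_with_card_n)
      thus False using X(3)[of W] i unfolding \<W>1_def by auto
    qed
    moreover have "0 \<le> 2 * (w * l\<^sup>2)" using wl by simp
    ultimately show ?thesis unfolding r_def mult.assoc by linarith
  qed
  moreover have "\<exists>i\<in>I. card (X' \<inter> L i) \<ge> 3" if X': "X' \<subseteq> X" "2 ^ 50 * w * l\<^sup>2 \<le> real (card X')" for X'
  proof (rule ccontr)
    assume "\<not> ?thesis"
    hence "card (X' \<inter> L i) \<le> 2" if "i \<in> I" for i using that by force
    hence "arc X'" unfolding arc_def using X' X(1) by blast
    have "t \<le> card X'" unfolding t_def using X'(2) unfolding mult.assoc by linarith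
    then obtain A where A: "A \<subseteq> X'" "card A = t" by (meson obtain_subset_with_card_n)
    have "A \<in> \<W>2" unfolding \<W>2_def using A arc_subset[OF \<open>arc X'\<close>] by blast
    thus False using X(3) A X'(1) by blast
  qed
  ultimately show ?thesis using finX finI cardI lin n1 X(2)
    by (intro exI[of _ I] exI[of _ L] exI[of _ X]) (auto simp: mult.assoc)
qed

theorem theorem5p4:
  "\<exists>C::real. C > 0 \<and>
     (\<exists>\<epsilon>::nat \<Rightarrow> real. \<epsilon> \<in> o(\<lambda>_. 1) \<and>
       (\<forall>\<^sub>F m in at_top.
          \<exists>(X::nat set) (Y::nat set) (E::nat set set).
            bipartite_graph X Y E \<and>
            C4_free E \<and>
            real (card X) \<ge> 1 / 2 * real m powr (3 / 4) * (ln (real m))\<^sup>2 \<and>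
            real (card Y) = (1 + \<epsilon> m) * real m \<and>
            (\<forall>y\<in>Y. real (vertex_degree E y) \<le> 2 * real m powr (1 / 4) * (ln (real m))\<^sup>2) \<and>
            (\<forall>X'\<subseteq>X. real (card X') \<ge> C * real m powr (1 / 4) * (ln (real m))\<^sup>2 \<longrightarrow>
               (\<exists>y\<in>Y. card (neighbourhood E y \<inter> X') \<ge> 3))))"
proof (intro exI conjI)
  show "(2 ^ 50 :: real) > 0" by simp
  \<comment> \<open>The padding by empty lines makes \<open>card Y\<close> exactly \<open>m\<close>,
    so the error term is zero.\<close>
  show "(\<lambda>_::nat. 0 :: real) \<in> o(\<lambda>_. 1)" by simp
  have "\<forall>\<^sub>F m::nat in at_top. 2 ^ 48 * ln (real m) \<le> real m powr (1 / 4)" by real_asymp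
  moreover have "\<forall>\<^sub>F m::nat in at_top. 4 \<le> (real m powr (1 / 4)) ^ 3 * (ln (real m))\<^sup>2" by real_asymp
  moreover have "\<forall>\<^sub>F m::nat in at_top. (ln (real m))\<^sup>2 \<le> real m powr (1 / 4)" by real_asymp
  ultimately show "\<forall>\<^sub>F m in at_top.
          \<exists>(X::nat set) (Y::nat set) (E::nat set set).
            bipartite_graph X Y E \<and>
            C4_free E \<and>
            real (card X) \<ge> 1 / 2 * real m powr (3 / 4) * (ln (real m))\<^sup>2 \<and>
            real (card Y) = (1 + 0) * real m \<and>
            (\<forall>y\<in>Y. real (vertex_degree E y) \<le> 2 * real m powr (1 / 4) * (ln (real m))\<^sup>2) \<and>
            (\<forall>X'\<subseteq>X. real (card X') \<ge> 2 ^ 50 * real m powr (1 / 4) * (ln (real m))\<^sup>2 \<longrightarrow>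
               (\<exists>y\<in>Y. card (neighbourhood E y \<inter> X') \<ge> 3))"
    using eventually_ge_at_top[of "2 ^ 60 :: nat"]
  proof eventually_elim
    case (elim m)
    define w where "w = real m powr (1 / 4)"
    define l where "l = ln (real m)"
    have m0: "real m > 0" using elim(4) by simp
    have w: "w > 0" "w ^ 4 = real m" "w ^ 3 = real m powr (3 / 4)"
      unfolding w_def using m0 by (simp_all add: powr_realpow[symmetric] powr_powr)
    from ex_sparse_arc_sample[OF elim(4) w(1,2) l_def elim(1-3)[folded w_def l_def]]
    obtain I L and X :: "(nat \<times> nat \<times> nat) set" where G: "finite X" "finite I" "card I = m"
      "\<forall>i j x y. i \<in> I \<longrightarrow> j \<in> I \<longrightarrow> x \<in> L i \<longrightarrow> y \<in> L i \<longrightarrow> x \<in> L j \<longrightarrow> y \<in> L j \<longrightarrow> x \<noteq> y \<longrightarrow> i = (j :: nat \<times> nat \<times> nat)"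
      "1 / 2 * w ^ 3 * l\<^sup>2 \<le> real (card X)"
      "\<forall>i\<in>I. real (card (X \<inter> L i)) \<le> 2 * w * l\<^sup>2"
      "\<forall>X'\<subseteq>X. 2 ^ 50 * w * l\<^sup>2 \<le> real (card X') \<longrightarrow> (\<exists>i\<in>I. card (X' \<inter> L i) \<ge> 3)"
      by (elim exE conjE)
    from ex_bipartite_graph_of_incidence[OF G(1,2,4)]
    obtain X' Y E and f g :: "nat \<times> nat \<times> nat \<Rightarrow> nat" where E: "bipartite_graph X' Y E" "C4_free E" "X' = f ` X" "inj f" "Y = g ` I" "inj g"
      "\<forall>i\<in>I. neighbourhood E (g i) = f ` (X \<inter> L i)"
      by (elim exE conjE)
    have cf: "card (f ` S) = card S" for S using E(4) by (meson card_image inj_on_subset subset_UNIV)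
    show ?case
    proof (intro exI conjI)
      show "bipartite_graph X' Y E" "C4_free E" by fact+
      show "1 / 2 * real m powr (3 / 4) * (ln (real m))\<^sup>2 \<le> real (card X')"
        using G(5) unfolding E(3) cf w(3) l_def .
      have "card Y = m" unfolding E(5) using E(6) G(3) by (metis card_image inj_on_subset subset_UNIV)
      thus "real (card Y) = (1 + 0) * real m" by simp
      show "\<forall>y\<in>Y. real (vertex_degree E y) \<le> 2 * real m powr (1 / 4) * (ln (real m))\<^sup>2"
        using G(6) E(7) unfolding E(5) vertex_degree_def w_def l_def by (auto simp: cf)
      show "\<forall>X''\<subseteq>X'. real (card X'') \<ge> 2 ^ 50 * real m powr (1 / 4) * (ln (real m))\<^sup>2 \<longrightarrow>
               (\<exists>y\<in>Y. card (neighbourhood E y \<inter> X'') \<ge> 3)"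
      proof (intro allI impI)
        fix X'' assume X'': "X'' \<subseteq> X'" "2 ^ 50 * real m powr (1 / 4) * (ln (real m))\<^sup>2 \<le> real (card X'')"
        obtain S where S: "S \<subseteq> X" "X'' = f ` S" using X''(1) unfolding E(3) by (meson subset_imageE)
        have "2 ^ 50 * w * l\<^sup>2 \<le> real (card S)" using X''(2) unfolding S(2) cf w_def l_def .
        then obtain i where i: "i \<in> I" "card (S \<inter> L i) \<ge> 3" using G(7) S(1) by blast
        have "neighbourhood E (g i) \<inter> X'' = f ` (S \<inter> L i)"
          using E(7) i(1) S E(4) by (auto simp: inj_eq)
        hence "card (neighbourhood E (g i) \<inter> X'') \<ge> 3" using i(2) cf by simp
        thus "\<exists>y\<in>Y. card (neighbourhood E y \<inter> X'') \<ge> 3" using i(1) E(5) by blast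
      qed
    qed
  qed
qed

end
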